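(* Let $(M,\omega)$ be a closed symplectic manifold of dimension $2m$. A symplectic connection $\nabla$ on $(M,\omega)$ gives a closed Fedosov star product $*_{\nabla}$ if and only if $\widetilde{\mu}(\nabla)=0$, where $\widetilde{\mu}(\nabla)$ is the linear functional on the space $C^\infty_0(M)$ of smooth functions with zero mean given by $\widetilde\mu(\nabla)(H)=-(2\pi)^m\cdot 24\cdot\nu^{m-2}\,\mathrm{tr}^{*_{\nabla}}(H)$.
   Context: Setting. $(M,\omega)$ is a closed symplectic manifold of dimension $2m$; in coordinates $\Lambda^{ij}$ is the inverse matrix of $\omega_{ij}$ ($\omega_{ij}\Lambda^{jk}=\delta_i^k$); repeated indices are summed. A symplectic connection is a torsion-free connection $\nabla$ on $TM$ with $\nabla\omega=0$. Fedosov construction. $\mathcal{W}$ is the formal Weyl algebra bundle; $\mathcal{W}$-valued forms are locally $\sum_{k,l\ge 0}\nu^k a_{k,i_1\dots i_l,j_1\dots j_p}(x)y^{i_1}\cdots y^{i_l}dx^{j_1}\wedge\dots\wedge dx^{j_p}$ (tensors symmetric in the $i$'s, antisymmetric in the $j$'s); the total degree of such a term is $2k+l$. The fibrewise product is $a\circ b=\left.\exp\left(\frac{\nu}{2}\Lambda^{ij}\partial_{y^i}\partial_{z^j}\right)a(y,\nu)b(z,\nu)\right|_{z=y}$, extended to forms by $(a\otimes\alpha)\circ(b\otimes\beta)=a\circ b\otimes\alpha\wedge\beta$; $[\cdot,\cdot]$ is the graded commutator. For a symplectic connection $\nabla$ with Christoffel symbols $\Gamma^k_{ij}$ put $\overline{\Gamma}=\frac12\omega_{lk}\Gamma^k_{ij}y^ly^jdx^i$,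 $\partial a=da+\frac1\nu[\overline\Gamma,a]$, $\delta a=dx^k\wedge\partial_{y^k}a$, $\delta^{-1}a=\frac{1}{p+q}y^k\imath(\partial_{x^k})a$ on $q$-forms with $p$ $y$'s, $p+q>0$ (and $\delta^{-1}=0$ if $p+q=0$), and $\overline R=\frac14\omega_{ir}R^r_{jkl}y^iy^jdx^k\wedge dx^l$ with $R^r_{jkl}=(R(\partial_k,\partial_l)\partial_j)^r$ the curvature of $\nabla$. There is a unique $\mathcal{W}$-valued $1$-form $r=r^\nabla$ of total degree at least $3$ with $\delta^{-1}r=0$ and $\overline R+\partial r-\delta r+\frac1\nu r\circ r=0$. Then $D^\nabla a:=\partial a-\delta a+\frac1\nu[r,a]$ satisfies $(D^\nabla)^2=0$; the map $a\mapsto a|_{y=0}$ is a bijection from $D^\nabla$-flat sections of $\mathcal{W}$ to $C^\infty(M)[[\nu]]$, with inverse denoted $Q^\nabla$; the Fedosov star product is $F*_\nabla G:=(Q^\nabla(F)\circ Q^\nabla(G))|_{y=0}$. Trace. $\mathrm{tr}^{*_\nabla}:C^\infty(M)[[\nu]]\to\mathbb{R}[\nu^{-1},\nu]]$ is the unique normalised trace of $*_\nabla$: it is $\nu$-linear, vanishes on $*_\nabla$-commutators, and for every contractible Darboux chart $U$, every local equivalence $T:(C^\infty(U)[[\nu]],*_\nabla)\to(C^\infty(U)[[\nu]],*_{\mathrm{Moyal}})$ and every $F\in C_c^\infty(U)[[\nu]]$ one has $\mathrm{tr}^{*_\nabla}(F)=\frac{1}{(2\pi\nu)^m}\int_M T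 F\,\frac{\omega^m}{m!}$. The trace density $\rho^\nabla\in C^\infty(M)[\nu^{-1},\nu]]$ is the formal function with $\mathrm{tr}^{*_\nabla}(F)=\int_M F\rho^\nabla\frac{\omega^m}{m!}$ for all $F$. The star product $*_\nabla$ is called closed if $\rho^\nabla$ is constant (on $M$). *)

theory Defs
  imports "HOL-Analysis.Analysis" "HOL-Computational_Algebra.Formal_Laurent_Series"
begin

no_notation fps_nth (infixl \<open>$\<close> 75)

section \<open>Smooth manifolds with a nondegenerate 2-form, in charts\<close>

type_synonym ('a, 'n) chart = "'a set \<times> ('a \<Rightarrow> real ^ 'n)"

text \<open>Tensorial data are families of components, one for each chart. The values of
  \<open>omega S c x\<close> for a chart \<open>c\<close> outside the atlas or a point \<open>x\<close> outside the domain of \<open>c\<close>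
  carry no meaning.\<close>

record ('a, 'n::finite) sympl_data =
  space_of :: "'a topology"
  charts :: "('a, 'n) chart set"
  omega :: "('a, 'n) chart \<Rightarrow> 'a \<Rightarrow> real ^ 'n ^ 'n"

abbreviation pts :: "('a, 'n::finite) sympl_data \<Rightarrow> 'a set" where
  "pts S \<equiv> topspace (space_of S)"

definition pderiv_vec :: "'n \<Rightarrow> (real ^ 'n \<Rightarrow> real) \<Rightarrow> real ^ 'n \<Rightarrow> real" where
  "pderiv_vec i f = (\<lambda>y. frechet_derivative f (at y) (axis i 1))"

text \<open>On an open set, differentiability of all iterated partial derivatives is smoothness.\<close>

definition smooth_fun_on :: "(real ^ 'n) set \<Rightarrow> (real ^ 'n \<Rightarrow> real) \<Rightarrow> bool" where
  "smooth_fun_on W f \<longleftrightarrow> (\<forall>u :: 'n list. \<forall>y \<in> W. foldr pderiv_vec u f differentiable (at y))"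

definition cinv :: "('a, 'n) chart \<Rightarrow> real ^ 'n \<Rightarrow> 'a" where
  "cinv c = the_inv_into (fst c) (snd c)"

definition topological_chart :: "'a topology \<Rightarrow> ('a, 'n::finite) chart \<Rightarrow> bool" where
  "topological_chart X c \<longleftrightarrow> openin X (fst c) \<and> open (snd c ` fst c) \<and>
     homeomorphic_map (subtopology X (fst c)) (top_of_set (snd c ` fst c)) (snd c)"

definition compatible :: "('a, 'n::finite) chart \<Rightarrow> ('a, 'n) chart \<Rightarrow> bool" where
  "compatible c d \<longleftrightarrow>
     (\<forall>k. smooth_fun_on (snd c ` (fst c \<inter> fst d)) (\<lambda>y. snd d (cinv c y) $ k))"

definition maximal_smooth_atlas :: "'a topology \<Rightarrow> ('a, 'n::finite) chart set \<Rightarrow> bool" where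
  "maximal_smooth_atlas X A \<longleftrightarrow>
     (\<forall>c \<in> A. topological_chart X c) \<and>
     (\<Union>c \<in> A. fst c) = topspace X \<and>
     (\<forall>c \<in> A. \<forall>d \<in> A. compatible c d) \<and>
     (\<forall>c. topological_chart X c \<and> (\<forall>d \<in> A. compatible c d \<and> compatible d c) \<longrightarrow> c \<in> A)"

text \<open>The operator \<open>\<partial>/\<partial>x\<^sup>i\<close> of the chart \<open>c\<close>, and its iterates along a list of indices.\<close>

definition cderiv :: "('a, 'n::finite) chart \<Rightarrow> 'n \<Rightarrow> ('a \<Rightarrow> real) \<Rightarrow> 'a \<Rightarrow> real" where
  "cderiv c i f = (\<lambda>x. pderiv_vec i (f \<circ> cinv c) (snd c x))"

definition cderivs :: "('a, 'n::finite) chart \<Rightarrow> 'n list \<Rightarrow> ('a \<Rightarrow> real) \<Rightarrow> 'a \<Rightarrow> real" where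
  "cderivs c u f = foldr (cderiv c) u f"

definition smooth_on :: "('a, 'n::finite) sympl_data \<Rightarrow> 'a set \<Rightarrow> ('a \<Rightarrow> real) \<Rightarrow> bool" where
  "smooth_on S V f \<longleftrightarrow>
     (\<forall>c \<in> charts S. smooth_fun_on (snd c ` (fst c \<inter> V)) (f \<circ> cinv c))"

text \<open>\<open>jac c d x k i\<close> is \<open>\<partial>x\<^sub>d\<^sup>k/\<partial>x\<^sub>c\<^sup>i\<close>.\<close>

definition jac :: "('a, 'n::finite) chart \<Rightarrow> ('a, 'n) chart \<Rightarrow> 'a \<Rightarrow> 'n \<Rightarrow> 'n \<Rightarrow> real" where
  "jac c d x k i = cderiv c i (\<lambda>p. snd d p $ k) x"

definition symplectic_form :: "('a, 'n::finite) sympl_data \<Rightarrow> bool" where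
  "symplectic_form S \<longleftrightarrow>
     (\<forall>c \<in> charts S. \<forall>i j. smooth_on S (fst c) (\<lambda>x. omega S c x $ i $ j)) \<and>
     (\<forall>c \<in> charts S. \<forall>d \<in> charts S. \<forall>x \<in> fst c \<inter> fst d. \<forall>i j.
        omega S c x $ i $ j =
          (\<Sum>k\<in>UNIV. \<Sum>l\<in>UNIV. jac c d x k i * jac c d x l j * omega S d x $ k $ l)) \<and>
     (\<forall>c \<in> charts S. \<forall>x \<in> fst c.
        (\<forall>i j. omega S c x $ i $ j = - omega S c x $ j $ i) \<and>
        invertible (omega S c x) \<and>
        (\<forall>i j k. cderiv c i (\<lambda>p. omega S c p $ j $ k) x
               + cderiv c j (\<lambda>p. omega S c p $ k $ i) x
               + cderiv c k (\<lambda>p. omega S c p $ i $ j) x = 0))"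

definition closed_symplectic_manifold :: "nat \<Rightarrow> ('a, 'n::finite) sympl_data \<Rightarrow> bool" where
  "closed_symplectic_manifold m S \<longleftrightarrow>
     CARD('n) = 2 * m \<and>
     Hausdorff_space (space_of S) \<and> second_countable (space_of S) \<and>
     compact_space (space_of S) \<and>
     maximal_smooth_atlas (space_of S) (charts S) \<and>
     symplectic_form S"

text \<open>\<open>\<Lambda>\<close>, with \<open>\<omega>\<^sub>i\<^sub>j \<Lambda>\<^sup>j\<^sup>k = \<delta>\<^sub>i\<^sup>k\<close>.\<close>

abbreviation Lam :: "('a, 'n::finite) sympl_data \<Rightarrow> ('a, 'n) chart \<Rightarrow> 'a \<Rightarrow> real ^ 'n ^ 'n" where
  "Lam S c x \<equiv> matrix_inv (omega S c x)"

text \<open>\<open>\<omega> = \<Sum>\<^sub>k dq\<^sup>k \<and> dp\<^sup>k\<close> for some labelling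
  \<open>q\<^sup>0, \<dots>, q\<^sup>m\<^sup>-\<^sup>1, p\<^sup>0, \<dots>, p\<^sup>m\<^sup>-\<^sup>1\<close> of the coordinates.\<close>

definition darboux_chart :: "nat \<Rightarrow> ('a, 'n::finite) sympl_data \<Rightarrow> ('a, 'n) chart \<Rightarrow> bool" where
  "darboux_chart m S c \<longleftrightarrow> c \<in> charts S \<and>
     (\<exists>e. bij_betw e {..<2 * m} (UNIV :: 'n set) \<and>
        (\<forall>x \<in> fst c. \<forall>a < 2 * m. \<forall>b < 2 * m. omega S c x $ e a $ e b =
            (if b = a + m then 1 else if a = b + m then - 1 else 0)))"

definition smooth_functions :: "('a, 'n::finite) sympl_data \<Rightarrow> 'a set \<Rightarrow> ('a \<Rightarrow> real) set" where
  "smooth_functions S V = {f. smooth_on S V f \<and> (\<forall>x. x \<notin> V \<longrightarrow> f x = 0)}"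

text \<open>\<open>C\<^sup>\<infinity>(V)[[\<nu>]]\<close>, an element being represented by its extension by zero.\<close>

definition formal_functions :: "('a, 'n::finite) sympl_data \<Rightarrow> 'a set \<Rightarrow> ('a \<Rightarrow> real fps) set" where
  "formal_functions S V = {F. \<forall>k. (\<lambda>x. fps_nth (F x) k) \<in> smooth_functions S V}"

text \<open>\<open>C\<^sub>c\<^sup>\<infinity>(U)[[\<nu>]]\<close>\<close>

definition formal_functions_cs ::
  "('a, 'n::finite) sympl_data \<Rightarrow> 'a set \<Rightarrow> ('a \<Rightarrow> real fps) set" where
  "formal_functions_cs S U = {F \<in> formal_functions S U.
     \<forall>k. \<exists>K. compactin (space_of S) K \<and> K \<subseteq> U \<and> (\<forall>x. x \<notin> K \<longrightarrow> fps_nth (F x) k = 0)}"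

text \<open>\<open>C\<^sup>\<infinity>(M)[\<nu>\<^sup>-\<^sup>1,\<nu>]]\<close>: the pole order is bounded uniformly on \<open>M\<close>.\<close>

definition laurent_functions :: "('a, 'n::finite) sympl_data \<Rightarrow> ('a \<Rightarrow> real fls) set" where
  "laurent_functions S = {\<rho>. (\<forall>k. (\<lambda>x. fls_nth (\<rho> x) k) \<in> smooth_functions S (pts S)) \<and>
     (\<exists>N. \<forall>x. \<forall>k < N. fls_nth (\<rho> x) k = 0)}"


section \<open>Integration against \<open>\<omega>\<^sup>m/m!\<close>\<close>

text \<open>The coefficient of \<open>\<omega>\<^sup>m/m!\<close>, with \<open>\<omega> = (1/2) \<omega>\<^sub>i\<^sub>j dx\<^sup>i \<and> dx\<^sup>j\<close>, with respect to
  \<open>dx\<^sup>e\<^sup>(\<^sup>0\<^sup>) \<and> \<dots> \<and> dx\<^sup>e\<^sup>(\<^sup>2\<^sup>m\<^sup>-\<^sup>1\<^sup>)\<close>. Changing the enumeration \<open>e\<close> of the coordinates can only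
  change its sign.\<close>

definition liouville_coeff ::
  "nat \<Rightarrow> ('a, 'n::finite) sympl_data \<Rightarrow> ('a, 'n) chart \<Rightarrow> 'a \<Rightarrow> real" where
  "liouville_coeff m S c x =
     (let e = (SOME e. bij_betw e {..<2 * m} (UNIV :: 'n set)) in
       (\<Sum>\<sigma> | \<sigma> permutes {..<2 * m}. of_int (sign \<sigma>) *
          (\<Prod>k<m. omega S c x $ e (\<sigma> (2 * k)) $ e (\<sigma> (2 * k + 1)))) / (2 ^ m * fact m))"

definition chart_partition ::
  "('a, 'n::finite) sympl_data \<Rightarrow> (('a, 'n) chart \<times> 'a set) set \<Rightarrow> bool" where
  "chart_partition S P \<longleftrightarrow> finite P \<and> disjoint_family_on snd P \<and> (\<Union>p\<in>P. snd p) = pts S \<and>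
     (\<forall>(c, B) \<in> P. c \<in> charts S \<and> snd c ` B \<in> sets borel \<and>
        (\<exists>K. compactin (space_of S) K \<and> B \<subseteq> K \<and> K \<subseteq> fst c))"

text \<open>\<open>M\<close> is oriented by \<open>\<omega>\<^sup>m\<close>, which is the reason for the absolute value. By the change of
  variables formula the sum does not depend on the chosen partition.\<close>

definition liouville_integral ::
  "nat \<Rightarrow> ('a, 'n::finite) sympl_data \<Rightarrow> ('a \<Rightarrow> real) \<Rightarrow> real" where
  "liouville_integral m S f =
     (\<Sum>(c, B) \<in> (SOME P. chart_partition S P).
        set_lebesgue_integral lborel (snd c ` B)
          (\<lambda>y. f (cinv c y) * \<bar>liouville_coeff m S c (cinv c y)\<bar>))"

definition liouville_integral_fls ::
  "nat \<Rightarrow> ('a, 'n::finite) sympl_data \<Rightarrow> ('a \<Rightarrow> real fls) \<Rightarrow> real fls" where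
  "liouville_integral_fls m S F =
     Abs_fls (\<lambda>k. liouville_integral m S (\<lambda>x. fls_nth (F x) k))"

definition zero_mean_functions ::
  "nat \<Rightarrow> ('a, 'n::finite) sympl_data \<Rightarrow> ('a \<Rightarrow> real) set" where
  "zero_mean_functions m S =
     {H \<in> smooth_functions S (pts S). liouville_integral m S H = 0}"


section \<open>Symplectic connections\<close>

text \<open>\<open>G c x k i j\<close> is the Christoffel symbol \<open>\<Gamma>\<^sup>k\<^sub>i\<^sub>j\<close>, where
  \<open>\<nabla>\<^sub>\<partial>\<^sub>i \<partial>\<^sub>j = \<Gamma>\<^sup>k\<^sub>i\<^sub>j \<partial>\<^sub>k\<close>.\<close>

type_synonym ('a, 'n) christoffel = "('a, 'n) chart \<Rightarrow> 'a \<Rightarrow> 'n \<Rightarrow> 'n \<Rightarrow> 'n \<Rightarrow> real"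

definition affine_connection ::
  "('a, 'n::finite) sympl_data \<Rightarrow> ('a, 'n) christoffel \<Rightarrow> bool" where
  "affine_connection S G \<longleftrightarrow>
     (\<forall>c \<in> charts S. \<forall>k i j. smooth_on S (fst c) (\<lambda>x. G c x k i j)) \<and>
     (\<forall>c \<in> charts S. \<forall>d \<in> charts S. \<forall>x \<in> fst c \<inter> fst d. \<forall>r i j.
        (\<Sum>k\<in>UNIV. jac c d x r k * G c x k i j) =
        (\<Sum>p\<in>UNIV. \<Sum>q\<in>UNIV. G d x r p q * jac c d x p i * jac c d x q j)
        + cderiv c i (cderiv c j (\<lambda>p. snd d p $ r)) x)"

definition symplectic_connection ::
  "('a, 'n::finite) sympl_data \<Rightarrow> ('a, 'n) christoffel \<Rightarrow> bool" where
  "symplectic_connection S G \<longleftrightarrow> affine_connection S G \<and>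
     (\<forall>c \<in> charts S. \<forall>x \<in> fst c. \<forall>i j k.
        G c x k i j = G c x k j i \<and>
        cderiv c i (\<lambda>p. omega S c p $ j $ k) x
          - (\<Sum>l\<in>UNIV. G c x l i j * omega S c x $ l $ k)
          - (\<Sum>l\<in>UNIV. G c x l i k * omega S c x $ j $ l) = 0)"

text \<open>\<open>curv G c x r j k l\<close> is \<open>R\<^sup>r\<^sub>j\<^sub>k\<^sub>l = (R(\<partial>\<^sub>k, \<partial>\<^sub>l) \<partial>\<^sub>j)\<^sup>r\<close>.\<close>

definition curv ::
  "('a, 'n::finite) christoffel \<Rightarrow> ('a, 'n) chart \<Rightarrow> 'a \<Rightarrow> 'n \<Rightarrow> 'n \<Rightarrow> 'n \<Rightarrow> 'n \<Rightarrow> real" where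
  "curv G c x r j k l =
     cderiv c k (\<lambda>p. G c p r l j) x - cderiv c l (\<lambda>p. G c p r k j) x
     + (\<Sum>s\<in>UNIV. G c x r k s * G c x s l j - G c x r l s * G c x s k j)"


section \<open>The formal Weyl algebra\<close>

text \<open>Formal power series in the variables \<open>y\<^sup>i\<close>, as functions of the multi-index, and in
  addition in \<open>\<nu>\<close>: \<open>a k \<alpha>\<close> is the coefficient of \<open>\<nu>\<^sup>k y\<^sup>\<alpha>\<close>.\<close>

type_synonym 'n yseries = "('n \<Rightarrow> nat) \<Rightarrow> real"
type_synonym 'n weyl = "nat \<Rightarrow> 'n yseries"

definition ymult :: "'n yseries \<Rightarrow> 'n yseries \<Rightarrow> 'n yseries" where
  "ymult f g = (\<lambda>\<alpha>. \<Sum>\<beta> | \<forall>i. \<beta> i \<le> \<alpha> i. f \<beta> * g (\<lambda>i. \<alpha> i - \<beta> i))"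

definition yderiv :: "'n \<Rightarrow> 'n yseries \<Rightarrow> 'n yseries" where
  "yderiv i f = (\<lambda>\<alpha>. real (Suc (\<alpha> i)) * f (\<alpha>(i := Suc (\<alpha> i))))"

definition yderivs :: "'n list \<Rightarrow> 'n yseries \<Rightarrow> 'n yseries" where
  "yderivs u f = foldr yderiv u f"

text \<open>The term of order \<open>n\<close> in the exponential is
  \<open>\<nu>\<^sup>n/(2\<^sup>n n!) \<Lambda>\<^sup>u\<^sup>1\<^sup>v\<^sup>1 \<dots> \<Lambda>\<^sup>u\<^sup>n\<^sup>v\<^sup>n \<partial>\<^sub>u\<^sub>1\<^sub>\<dots>\<^sub>u\<^sub>n a \<partial>\<^sub>v\<^sub>1\<^sub>\<dots>\<^sub>v\<^sub>n b\<close>.\<close>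

definition circ :: "real ^ 'n ^ 'n \<Rightarrow> 'n::finite weyl \<Rightarrow> 'n weyl \<Rightarrow> 'n weyl" where
  "circ L a b = (\<lambda>k \<alpha>. \<Sum>n\<le>k. \<Sum>j\<le>k - n.
     (\<Sum>u | length u = n. \<Sum>v | length v = n.
        (\<Prod>t<n. L $ (u ! t) $ (v ! t)) *
        ymult (yderivs u (a j)) (yderivs v (b (k - n - j))) \<alpha>) / (2 ^ n * fact n))"

text \<open>Division by \<open>\<nu>\<close>, to be used for series without term of order \<open>0\<close> in \<open>\<nu>\<close>, such as
  graded commutators.\<close>

definition div_nu :: "'n weyl \<Rightarrow> 'n weyl" where
  "div_nu a = (\<lambda>k. a (Suc k))"

definition quadratic :: "('n \<Rightarrow> 'n \<Rightarrow> real) \<Rightarrow> 'n::finite weyl" where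
  "quadratic A = (\<lambda>k \<alpha>. if k = 0
     then \<Sum>i\<in>UNIV. \<Sum>j\<in>UNIV. if \<alpha> = (\<lambda>s. of_bool (s = i) + of_bool (s = j)) then A i j else 0
     else 0)"

text \<open>\<open>\<W>\<close>-valued forms at a point, in a chart: a 1-form \<open>a\<^sub>i dx\<^sup>i\<close> is given by its components
  \<open>a\<^sub>i\<close>, and a 2-form \<open>(1/2) a\<^sub>i\<^sub>j dx\<^sup>i \<and> dx\<^sup>j\<close> by its antisymmetric components \<open>a\<^sub>i\<^sub>j\<close>. The
  graded commutator of two 1-forms is \<open>a \<circ> b + b \<circ> a\<close>.\<close>

definition comm10 :: "real ^ 'n ^ 'n \<Rightarrow> ('n \<Rightarrow> 'n weyl) \<Rightarrow> 'n::finite weyl \<Rightarrow> 'n \<Rightarrow> 'n weyl" where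
  "comm10 L a b i = (\<lambda>k \<alpha>. circ L (a i) b k \<alpha> - circ L b (a i) k \<alpha>)"

definition circ11 ::
  "real ^ 'n ^ 'n \<Rightarrow> ('n \<Rightarrow> 'n weyl) \<Rightarrow> ('n \<Rightarrow> 'n weyl) \<Rightarrow> 'n::finite \<Rightarrow> 'n \<Rightarrow> 'n weyl" where
  "circ11 L a b i j = (\<lambda>k \<alpha>. circ L (a i) (b j) k \<alpha> - circ L (a j) (b i) k \<alpha>)"

definition comm11 ::
  "real ^ 'n ^ 'n \<Rightarrow> ('n \<Rightarrow> 'n weyl) \<Rightarrow> ('n \<Rightarrow> 'n weyl) \<Rightarrow> 'n::finite \<Rightarrow> 'n \<Rightarrow> 'n weyl" where
  "comm11 L a b i j = (\<lambda>k \<alpha>. circ11 L a b i j k \<alpha> + circ11 L b a i j k \<alpha>)"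

text \<open>\<open>\<delta>\<^sup>-\<^sup>1\<close> on 1-forms; the factor \<open>1/(p + 1)\<close> is the inverse of the \<open>y\<close>-degree of the result.\<close>

definition delta_inv :: "('n \<Rightarrow> 'n weyl) \<Rightarrow> 'n::finite weyl" where
  "delta_inv a = (\<lambda>k \<alpha>. (\<Sum>i | 0 < \<alpha> i. a i k (\<alpha>(i := \<alpha> i - 1))) / real (\<Sum>i\<in>UNIV. \<alpha> i))"


section \<open>Sections of the Weyl bundle\<close>

type_synonym ('a, 'n) wsection = "('a, 'n) chart \<Rightarrow> 'a \<Rightarrow> 'n weyl"
type_synonym ('a, 'n) wform = "('a, 'n) chart \<Rightarrow> 'a \<Rightarrow> 'n \<Rightarrow> 'n weyl"

text \<open>For a list \<open>u\<close> of length \<open>l\<close>, the value \<open>yderivs u (a k) (\<lambda>_. 0)\<close> is \<open>l!\<close> times the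
  symmetric tensor component \<open>a\<^sub>k\<^sub>,\<^sub>u\<^sub>1\<^sub>\<dots>\<^sub>u\<^sub>l\<close>; it has to transform as a covariant tensor.
  Sections over an open set are extended by zero, which makes them equal as functions as
  soon as they are equal as sections.\<close>

definition weyl_sections :: "('a, 'n::finite) sympl_data \<Rightarrow> 'a set \<Rightarrow> ('a, 'n) wsection set" where
  "weyl_sections S V = {a.
     (\<forall>c x. \<not> (c \<in> charts S \<and> x \<in> fst c \<inter> V) \<longrightarrow> a c x = (\<lambda>k \<alpha>. 0)) \<and>
     (\<forall>c \<in> charts S. \<forall>k \<alpha>. smooth_on S (fst c \<inter> V) (\<lambda>x. a c x k \<alpha>)) \<and>
     (\<forall>c \<in> charts S. \<forall>d \<in> charts S. \<forall>x \<in> fst c \<inter> fst d \<inter> V. \<forall>k u.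
        yderivs u (a c x k) (\<lambda>_. 0) =
          (\<Sum>v | length v = length u.
             (\<Prod>t<length u. jac c d x (v ! t) (u ! t)) * yderivs v (a d x k) (\<lambda>_. 0)))}"

definition weyl_1forms :: "('a, 'n::finite) sympl_data \<Rightarrow> ('a, 'n) wform set" where
  "weyl_1forms S = {r.
     (\<forall>c x. \<not> (c \<in> charts S \<and> x \<in> fst c) \<longrightarrow> r c x = (\<lambda>i k \<alpha>. 0)) \<and>
     (\<forall>c \<in> charts S. \<forall>i k \<alpha>. smooth_on S (fst c) (\<lambda>x. r c x i k \<alpha>)) \<and>
     (\<forall>c \<in> charts S. \<forall>d \<in> charts S. \<forall>x \<in> fst c \<inter> fst d. \<forall>i k u.
        yderivs u (r c x i k) (\<lambda>_. 0) =
          (\<Sum>j\<in>UNIV. \<Sum>v | length v = length u.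
             jac c d x j i * (\<Prod>t<length u. jac c d x (v ! t) (u ! t)) *
             yderivs v (r d x j k) (\<lambda>_. 0)))}"


section \<open>The Fedosov construction\<close>

text \<open>The formula for \<open>\<partial>\<close> in terms of \<open>\<Gamma>\<close> below is the covariant derivative only where
  \<open>\<omega>\<^sub>l\<^sub>k \<Gamma>\<^sup>k\<^sub>i\<^sub>j\<close> is symmetric in \<open>l\<close> and \<open>j\<close>, which for a symplectic connection is the case
  in Darboux charts but not in general ones. The equations involving \<open>\<partial>\<close> are therefore
  imposed in Darboux charts, and these cover \<open>M\<close>.\<close>

definition Gamma_bar ::
  "('a, 'n::finite) sympl_data \<Rightarrow> ('a, 'n) christoffel \<Rightarrow> ('a, 'n) wform" where
  "Gamma_bar S G c x i =
     quadratic (\<lambda>l j. (\<Sum>k\<in>UNIV. omega S c x $ l $ k * G c x k i j) / 2)"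

definition R_bar ::
  "('a, 'n::finite) sympl_data \<Rightarrow> ('a, 'n) christoffel \<Rightarrow> ('a, 'n) chart \<Rightarrow> 'a
     \<Rightarrow> 'n \<Rightarrow> 'n \<Rightarrow> 'n weyl" where
  "R_bar S G c x k l =
     quadratic (\<lambda>i j. (\<Sum>r\<in>UNIV. omega S c x $ i $ r * curv G c x r j k l) / 2)"

definition cov0 ::
  "('a, 'n::finite) sympl_data \<Rightarrow> ('a, 'n) christoffel \<Rightarrow> ('a, 'n) wsection
     \<Rightarrow> ('a, 'n) wform" where
  "cov0 S G a c x i = (\<lambda>k \<alpha>. cderiv c i (\<lambda>p. a c p k \<alpha>) x
     + div_nu (comm10 (Lam S c x) (Gamma_bar S G c x) (a c x) i) k \<alpha>)"

definition cov1 ::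
  "('a, 'n::finite) sympl_data \<Rightarrow> ('a, 'n) christoffel \<Rightarrow> ('a, 'n) wform
     \<Rightarrow> ('a, 'n) chart \<Rightarrow> 'a \<Rightarrow> 'n \<Rightarrow> 'n \<Rightarrow> 'n weyl" where
  "cov1 S G r c x i j = (\<lambda>k \<alpha>.
     cderiv c i (\<lambda>p. r c p j k \<alpha>) x - cderiv c j (\<lambda>p. r c p i k \<alpha>) x
     + div_nu (comm11 (Lam S c x) (Gamma_bar S G c x) (r c x) i j) k \<alpha>)"

definition is_fedosov_r ::
  "nat \<Rightarrow> ('a, 'n::finite) sympl_data \<Rightarrow> ('a, 'n) christoffel \<Rightarrow> ('a, 'n) wform \<Rightarrow> bool" where
  "is_fedosov_r m S G r \<longleftrightarrow> r \<in> weyl_1forms S \<and>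
     (\<forall>c \<in> charts S. \<forall>x \<in> fst c.
        (\<forall>i k \<alpha>. 2 * k + (\<Sum>s\<in>UNIV. \<alpha> s) < 3 \<longrightarrow> r c x i k \<alpha> = 0) \<and>
        (\<forall>k \<alpha>. delta_inv (r c x) k \<alpha> = 0)) \<and>
     (\<forall>c x i j k \<alpha>. darboux_chart m S c \<and> x \<in> fst c \<longrightarrow>
        R_bar S G c x i j k \<alpha> + cov1 S G r c x i j k \<alpha>
        - (yderiv i (r c x j k) \<alpha> - yderiv j (r c x i k) \<alpha>)
        + div_nu (circ11 (Lam S c x) (r c x) (r c x) i j) k \<alpha> = 0)"

definition fedosov_r ::
  "nat \<Rightarrow> ('a, 'n::finite) sympl_data \<Rightarrow> ('a, 'n) christoffel \<Rightarrow> ('a, 'n) wform" where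
  "fedosov_r m S G = (THE r. is_fedosov_r m S G r)"

definition fedosov_D ::
  "nat \<Rightarrow> ('a, 'n::finite) sympl_data \<Rightarrow> ('a, 'n) christoffel \<Rightarrow> ('a, 'n) wsection
     \<Rightarrow> ('a, 'n) wform" where
  "fedosov_D m S G a c x i = (\<lambda>k \<alpha>. cov0 S G a c x i k \<alpha> - yderiv i (a c x k) \<alpha>
     + div_nu (comm10 (Lam S c x) (fedosov_r m S G c x) (a c x) i) k \<alpha>)"

definition flat_sections ::
  "nat \<Rightarrow> ('a, 'n::finite) sympl_data \<Rightarrow> ('a, 'n) christoffel \<Rightarrow> 'a set
     \<Rightarrow> ('a, 'n) wsection set" where
  "flat_sections m S G V = {a \<in> weyl_sections S V.
     \<forall>c x i k \<alpha>. darboux_chart m S c \<and> x \<in> fst c \<inter> V \<longrightarrow> fedosov_D m S G a c x i k \<alpha> = 0}"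

text \<open>The restriction \<open>a|\<^sub>y\<^sub>=\<^sub>0\<close>; by the transformation law (with the empty list of indices)
  it does not depend on the chart.\<close>

definition chart_at :: "('a, 'n::finite) sympl_data \<Rightarrow> 'a \<Rightarrow> ('a, 'n) chart" where
  "chart_at S x = (SOME c. c \<in> charts S \<and> x \<in> fst c)"

definition at_y0 :: "('a, 'n::finite) sympl_data \<Rightarrow> ('a, 'n) wsection \<Rightarrow> 'a \<Rightarrow> real fps" where
  "at_y0 S a x = Abs_fps (\<lambda>k. a (chart_at S x) x k (\<lambda>_. 0))"

text \<open>All objects are defined over an arbitrary open set \<open>V\<close>, since the normalisation of the
  trace involves the star product on \<open>C\<^sup>\<infinity>(U)[[\<nu>]]\<close> for charts \<open>U\<close>.\<close>

definition fedosov_Q ::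
  "nat \<Rightarrow> ('a, 'n::finite) sympl_data \<Rightarrow> ('a, 'n) christoffel \<Rightarrow> 'a set
     \<Rightarrow> ('a \<Rightarrow> real fps) \<Rightarrow> ('a, 'n) wsection" where
  "fedosov_Q m S G V F = (THE a. a \<in> flat_sections m S G V \<and> (\<forall>x \<in> V. at_y0 S a x = F x))"

definition fedosov_star ::
  "nat \<Rightarrow> ('a, 'n::finite) sympl_data \<Rightarrow> ('a, 'n) christoffel \<Rightarrow> 'a set
     \<Rightarrow> ('a \<Rightarrow> real fps) \<Rightarrow> ('a \<Rightarrow> real fps) \<Rightarrow> 'a \<Rightarrow> real fps" where
  "fedosov_star m S G V F H = (\<lambda>x. if x \<in> V
     then at_y0 S (\<lambda>c p. circ (Lam S c p) (fedosov_Q m S G V F c p) (fedosov_Q m S G V H c p)) x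
     else 0)"


section \<open>The normalised trace, its density and the functional \<open>\<mu>\<close>\<close>

definition moyal_star ::
  "('a, 'n::finite) sympl_data \<Rightarrow> ('a, 'n) chart
     \<Rightarrow> ('a \<Rightarrow> real fps) \<Rightarrow> ('a \<Rightarrow> real fps) \<Rightarrow> 'a \<Rightarrow> real fps" where
  "moyal_star S c F H = (\<lambda>x. if x \<in> fst c
     then Abs_fps (\<lambda>k. \<Sum>n\<le>k. \<Sum>j\<le>k - n.
       (\<Sum>u | length u = n. \<Sum>v | length v = n.
          (\<Prod>t<n. Lam S c x $ (u ! t) $ (v ! t)) *
          cderivs c u (\<lambda>p. fps_nth (F p) j) x *
          cderivs c v (\<lambda>p. fps_nth (H p) (k - n - j)) x) / (2 ^ n * fact n))
     else 0)"

definition differential_operator ::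
  "('a, 'n::finite) sympl_data \<Rightarrow> ('a, 'n) chart \<Rightarrow> (('a \<Rightarrow> real) \<Rightarrow> 'a \<Rightarrow> real) \<Rightarrow> bool" where
  "differential_operator S c P \<longleftrightarrow>
     (\<exists>N b. (\<forall>u. smooth_on S (fst c) (b u)) \<and>
        (\<forall>f \<in> smooth_functions S (fst c). \<forall>x \<in> fst c.
           P f x = (\<Sum>u | length u \<le> N. b u x * cderivs c u f x)))"

text \<open>The operator \<open>\<Sum>\<^sub>k \<nu>\<^sup>k T\<^sub>k\<close> on \<open>C\<^sup>\<infinity>(U)[[\<nu>]]\<close>.\<close>

definition formal_op ::
  "'a set \<Rightarrow> (nat \<Rightarrow> ('a \<Rightarrow> real) \<Rightarrow> 'a \<Rightarrow> real) \<Rightarrow> ('a \<Rightarrow> real fps) \<Rightarrow> 'a \<Rightarrow> real fps" where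
  "formal_op U T F = (\<lambda>x. if x \<in> U
     then Abs_fps (\<lambda>n. \<Sum>k\<le>n. T k (\<lambda>p. fps_nth (F p) (n - k)) x)
     else 0)"

definition local_equivalence ::
  "nat \<Rightarrow> ('a, 'n::finite) sympl_data \<Rightarrow> ('a, 'n) christoffel \<Rightarrow> ('a, 'n) chart
     \<Rightarrow> (nat \<Rightarrow> ('a \<Rightarrow> real) \<Rightarrow> 'a \<Rightarrow> real) \<Rightarrow> bool" where
  "local_equivalence m S G c T \<longleftrightarrow>
     (\<forall>f \<in> smooth_functions S (fst c). \<forall>x \<in> fst c. T 0 f x = f x) \<and>
     (\<forall>k \<ge> 1. differential_operator S c (T k)) \<and>
     (\<forall>F \<in> formal_functions S (fst c). \<forall>H \<in> formal_functions S (fst c).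
        formal_op (fst c) T (fedosov_star m S G (fst c) F H) =
        moyal_star S c (formal_op (fst c) T F) (formal_op (fst c) T H))"

definition normalised_trace ::
  "nat \<Rightarrow> ('a, 'n::finite) sympl_data \<Rightarrow> ('a, 'n) christoffel
     \<Rightarrow> (('a \<Rightarrow> real fps) \<Rightarrow> real fls) \<Rightarrow> bool" where
  "normalised_trace m S G tr \<longleftrightarrow>
     (\<forall>F \<in> formal_functions S (pts S). \<forall>H \<in> formal_functions S (pts S).
        tr (\<lambda>x. F x + H x) = tr F + tr H) \<and>
     (\<forall>F \<in> formal_functions S (pts S). \<forall>z. tr (\<lambda>x. z * F x) = fps_to_fls z * tr F) \<and>
     (\<forall>F \<in> formal_functions S (pts S). \<forall>H \<in> formal_functions S (pts S).
        tr (\<lambda>x. fedosov_star m S G (pts S) F H x - fedosov_star m S G (pts S) H F x) = 0) \<and>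
     (\<forall>c T F. darboux_chart m S c \<and> contractible_space (subtopology (space_of S) (fst c)) \<and>
        local_equivalence m S G c T \<and> F \<in> formal_functions_cs S (fst c) \<longrightarrow>
        tr F = fls_const (1 / (2 * pi) ^ m) * fls_X_intpow (- int m) *
          liouville_integral_fls m S (\<lambda>x. fps_to_fls (formal_op (fst c) T F x)))"

definition is_trace_density ::
  "nat \<Rightarrow> ('a, 'n::finite) sympl_data \<Rightarrow> (('a \<Rightarrow> real fps) \<Rightarrow> real fls)
     \<Rightarrow> ('a \<Rightarrow> real fls) \<Rightarrow> bool" where
  "is_trace_density m S tr \<rho> \<longleftrightarrow> \<rho> \<in> laurent_functions S \<and>
     (\<forall>F \<in> formal_functions S (pts S).
        tr F = liouville_integral_fls m S (\<lambda>x. fps_to_fls (F x) * \<rho> x))"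

text \<open>Closedness of a star product, in terms of the density \<open>\<rho>\<close> of its normalised trace.\<close>

definition closed_star_product :: "('a, 'n::finite) sympl_data \<Rightarrow> ('a \<Rightarrow> real fls) \<Rightarrow> bool" where
  "closed_star_product S \<rho> \<longleftrightarrow> (\<exists>z. \<forall>x \<in> pts S. \<rho> x = z)"

definition mu_tilde ::
  "nat \<Rightarrow> (('a \<Rightarrow> real fps) \<Rightarrow> real fls) \<Rightarrow> ('a \<Rightarrow> real) \<Rightarrow> real fls" where
  "mu_tilde m tr H =
     - fls_const ((2 * pi) ^ m * 24) * fls_X_intpow (int m - 2) * tr (\<lambda>x. fps_const (H x))"

end

theory Submission
  imports Defs
begin

text \<open>The coefficient of \<open>\<nu>\<^sup>k\<close> in the trace of \<open>H\<close> is the integral of \<open>H \<rho>\<^sub>k\<close>, so the functional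
  vanishes iff every \<open>\<rho>\<^sub>k\<close> is orthogonal to all functions of zero mean. If so, testing with
  \<open>H = \<rho>\<^sub>k - a\<close>, where \<open>a\<close> is the mean of \<open>\<rho>\<^sub>k\<close>, makes the integral of \<open>H\<^sup>2\<close> vanish, and
  \<open>\<rho>\<^sub>k\<close> is the constant \<open>a\<close>. This uses that the Liouville integral of a continuous nonnegative
  function vanishes only for the zero function: transition maps preserve null sets, and the
  coefficient of \<open>\<omega>\<^sup>m\<close> is a multiple of the Pfaffian of \<open>\<omega>\<close>. The Pfaffian is nonzero because it is
  the value on the coordinate basis of an alternating form which does not vanish on a symplectic
  basis.\<close>

section \<open>Nonvanishing of the Pfaffian\<close>

text \<open>For antisymmetric \<open>W\<close> this is \<open>2 ^ m * fact m\<close> times the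
  Pfaffian. The indices are natural numbers rather than coordinates, so that vectors as well as
  coordinate labels can be put into the slots.\<close>

definition pfaffian_sum :: "nat \<Rightarrow> (nat \<Rightarrow> nat \<Rightarrow> real) \<Rightarrow> real" where
  "pfaffian_sum m W = (\<Sum>\<sigma> | \<sigma> permutes {..<2 * m}.
     of_int (sign \<sigma>) * (\<Prod>k<m. W (\<sigma> (2 * k)) (\<sigma> (2 * k + 1))))"

text \<open>The Gram matrix of a symplectic basis listed in adjacent conjugate pairs
  \<open>2 * k\<close>, \<open>2 * k + 1\<close>, the order in which the factors of
  \<open>pfaffian_sum\<close> pair their arguments.\<close>

definition std_form :: "nat \<Rightarrow> nat \<Rightarrow> real" where
  "std_form i j = (if i div 2 = j div 2 then real (j mod 2) - real (i mod 2) else 0)"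

text \<open>Reindex the sum by \<open>p \<circ> q\<close>; the sign is multiplicative.\<close>

lemma pfaffian_sum_permute:
  assumes p: "p permutes {..<2 * m}"
  shows "pfaffian_sum m W = of_int (sign p) * pfaffian_sum m (\<lambda>i j. W (p i) (p j))"
proof -
  have "sign (p \<circ> q) = sign p * sign q" if "q permutes {..<2 * m}" for q
    using p that by (intro sign_compose) (auto intro: permutation_permutes[THEN iffD2])
  then show ?thesis
    unfolding pfaffian_sum_def sum_distrib_left
    by (subst setum_permutations_compose_left[OF p]) (auto intro!: sum.cong)
qed

text \<open>Exchanges the pairs \<open>{2 a, 2 a + 1}\<close> and \<open>{2 b, 2 b + 1}\<close>, which is an even permutation.\<close>

definition pair_swap :: "nat \<Rightarrow> nat \<Rightarrow> nat \<Rightarrow> nat" where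
  "pair_swap a b i = 2 * Transposition.transpose a b (i div 2) + i mod 2"

lemma pair_swap_eq: "pair_swap a b = Transposition.transpose (2 * a) (2 * b) \<circ> Transposition.transpose (2 * a + 1) (2 * b + 1)"
proof
  fix i :: nat
  have "i = 2 * (i div 2) \<or> i = 2 * (i div 2) + 1" by presburger
  then obtain k where "i = 2 * k \<or> i = 2 * k + 1" by blast
  then show "pair_swap a b i = (Transposition.transpose (2 * a) (2 * b) \<circ> Transposition.transpose (2 * a + 1) (2 * b + 1)) i"
    by (auto simp: pair_swap_def Transposition.transpose_def; presburger)
qed

lemma pair_swap_permutes:
  "a < m \<Longrightarrow> b < m \<Longrightarrow> pair_swap a b permutes {..<2 * m}"
  unfolding pair_swap_eq by (intro permutes_compose permutes_swap_id) auto

lemma sign_pair_swap: "sign (pair_swap a b) = 1"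
  unfolding pair_swap_eq
  by (subst sign_compose) (auto simp: sign_swap_id permutation_swap_id)

lemma std_form_pair_swap: "std_form (pair_swap a b i) (pair_swap a b j) = std_form i j"
  by (auto simp: std_form_def pair_swap_def Transposition.transpose_def)

text \<open>This rules out cancellation in the Pfaffian sum of \<open>std_form\<close>: every signed
  term is \<open>0\<close> or \<open>1\<close>. Induction on the number of pairs: a nonzero product
  forces the last two arguments into one pair, which an even permutation moves to the last place. If
  that pair is then reversed, one transposition changes the sign of the permutation and of the
  product alike.\<close>

lemma prod_std_form:
  "\<sigma> permutes {..<2 * m} \<Longrightarrow>
     (\<Prod>k<m. std_form (\<sigma> (2 * k)) (\<sigma> (2 * k + 1))) \<in> {0, of_int (sign \<sigma>)}"
proof (induction m arbitrary: \<sigma>)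
  case 0
  then show ?case by simp
next
  case (Suc m)
  define P where "P \<sigma> = (\<Prod>k<Suc m. std_form (\<sigma> (2 * k)) (\<sigma> (2 * k + 1)))" for \<sigma>
  have fixed: "P \<tau> \<in> {0, of_int (sign \<tau>)}"
    if t: "\<tau> permutes {..<2 * Suc m}" "\<tau> (2 * m) = 2 * m" "\<tau> (2 * m + 1) = 2 * m + 1" for \<tau>
  proof -
    have "\<tau> permutes {..<2 * m}"
      using t(1)
    proof (rule permutes_superset)
      show "\<tau> i = i" if "i \<in> {..<2 * Suc m} - {..<2 * m}" for i
      proof -
        have "i = 2 * m \<or> i = 2 * m + 1" using that by auto
        then show ?thesis using t by auto
      qed
    qed
    moreover have "std_form (2 * m) (2 * m + 1) = 1" by (simp add: std_form_def)
    ultimately show ?thesis using Suc.IH[of \<tau>] t(2,3) by (simp add: P_def)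
  qed
  show ?case
  proof (cases "P \<sigma> = 0")
    case True
    then show ?thesis by (simp add: P_def)
  next
    case False
    then have nz: "std_form (\<sigma> (2 * m)) (\<sigma> (2 * m + 1)) \<noteq> 0"
      by (auto simp: P_def)
    \<comment> \<open>By \<open>nz\<close> both \<open>\<sigma> (2 * m)\<close> and
      \<open>\<sigma> (2 * m + 1)\<close> lie in pair number \<open>a\<close>. Swapping pairs
      \<open>a\<close> and \<open>m\<close> changes neither the product nor the sign.\<close>
    define a where "a = \<sigma> (2 * m) div 2"
    have "\<sigma> (2 * m) < 2 * Suc m"
      using permutes_in_image[OF Suc.prems, of "2 * m"] by simp
    then have a: "a < Suc m" unfolding a_def by presburger
    define \<tau> where "\<tau> = pair_swap a m \<circ> \<sigma>"
    have sw: "pair_swap a m permutes {..<2 * Suc m}" using a by (intro pair_swap_permutes) auto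
    have \<tau>: "\<tau> permutes {..<2 * Suc m}"
      unfolding \<tau>_def using Suc.prems sw by (rule permutes_compose)
    have perm: "permutation (pair_swap a m)" "permutation \<sigma>" "permutation \<tau>"
      using sw Suc.prems \<tau> permutation_permutes by blast+
    have P\<tau>: "P \<tau> = P \<sigma>" by (simp add: P_def \<tau>_def std_form_pair_swap)
    have sg: "sign \<tau> = sign \<sigma>"
      unfolding \<tau>_def using perm by (simp add: sign_compose sign_pair_swap)
    have d: "\<tau> (2 * m) div 2 = m" "\<tau> (2 * m + 1) div 2 = m"
      using nz by (auto simp: \<tau>_def pair_swap_def a_def std_form_def split: if_splits)
    have ne: "\<tau> (2 * m) \<noteq> \<tau> (2 * m + 1)"
      using permutes_inj[OF \<tau>] by (metis Suc_eq_plus1 injD n_not_Suc_n)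
    have cases: "\<tau> (2 * m) = 2 * m \<and> \<tau> (2 * m + 1) = 2 * m + 1 \<or>
        \<tau> (2 * m) = 2 * m + 1 \<and> \<tau> (2 * m + 1) = 2 * m"
      using d ne by presburger
    have "P \<tau> \<in> {0, of_int (sign \<tau>)}"
    proof (cases "\<tau> (2 * m) = 2 * m")
      case True
      then show ?thesis using fixed[OF \<tau>] cases by auto
    next
      case False
      with cases have sw2: "\<tau> (2 * m) = 2 * m + 1" "\<tau> (2 * m + 1) = 2 * m" by auto
      \<comment> \<open>Undoing the reversal of the last pair gives a permutation covered by
        \<open>fixed\<close>. Only the last factor changes, from \<open>- 1\<close> to
        \<open>1\<close>.\<close>
      define \<upsilon> where "\<upsilon> = Transposition.transpose (2 * m) (2 * m + 1) \<circ> \<tau>"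
      have \<upsilon>: "\<upsilon> permutes {..<2 * Suc m}"
        unfolding \<upsilon>_def using \<tau> by (rule permutes_compose) (auto intro: permutes_swap_id)
      have sgu: "sign \<upsilon> = - sign \<tau>"
        unfolding \<upsilon>_def using perm by (simp add: sign_compose permutation_swap_id sign_swap_id)
      have other: "\<upsilon> i = \<tau> i" if "i < 2 * m" for i
      proof -
        have "\<tau> i \<noteq> \<tau> (2 * m)" "\<tau> i \<noteq> \<tau> (2 * m + 1)"
          using permutes_inj[OF \<tau>] that by (metis injD less_irrefl, metis injD not_add_less1)
        then show ?thesis using sw2 by (simp add: \<upsilon>_def Transposition.transpose_def)
      qed
      have u: "\<upsilon> (2 * m) = 2 * m" "\<upsilon> (2 * m + 1) = 2 * m + 1"
        using sw2 by (simp_all add: \<upsilon>_def)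
      have "(\<Prod>k<m. std_form (\<upsilon> (2 * k)) (\<upsilon> (2 * k + 1))) =
          (\<Prod>k<m. std_form (\<tau> (2 * k)) (\<tau> (2 * k + 1)))"
        using other by (intro prod.cong refl) simp
      moreover have "std_form (2 * m) (2 * m + 1) = 1" "std_form (2 * m + 1) (2 * m) = - 1"
        by (simp_all add: std_form_def)
      ultimately have "P \<upsilon> = - P \<tau>"
        unfolding P_def prod.lessThan_Suc by (simp only: u sw2)
      then show ?thesis using fixed[OF \<upsilon> u] sgu by auto
    qed
    then show ?thesis unfolding P\<tau> sg by (simp only: P_def)
  qed
qed

text \<open>All terms are nonnegative and the identity contributes \<open>1\<close>.\<close>

lemma pfaffian_sum_std_form: "pfaffian_sum m std_form > 0"
proof -
  have t: "of_int (sign \<sigma>) * (\<Prod>k<m. std_form (\<sigma> (2 * k)) (\<sigma> (2 * k + 1))) \<ge> 0"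
    if "\<sigma> permutes {..<2 * m}" for \<sigma>
    using prod_std_form[OF that] by (auto simp: sign_def simp del: prod_zero_iff)
  have "0 < of_int (sign (id :: nat \<Rightarrow> nat)) * (\<Prod>k<m. std_form (id (2 * k)) (id (2 * k + 1)))"
    by (simp add: sign_id std_form_def)
  then show ?thesis
    unfolding pfaffian_sum_def using t permutes_id
    by (intro sum_pos2[where i = id]) (auto simp: finite_permutations)
qed

section \<open>Multilinearity and alternation of the Pfaffian sum\<close>

definition bil :: "real ^ 'n ^ 'n \<Rightarrow> real ^ 'n \<Rightarrow> real ^ 'n::finite \<Rightarrow> real" where
  "bil A x y = x \<bullet> (A *v y)"

lemma bil_axis: "bil A (axis i 1) (axis j 1) = A $ i $ j"
  by (simp add: bil_def inner_axis' matrix_vector_mul_component inner_axis)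

lemma linear_bil_left: "linear (\<lambda>x. bil A x y)"
  by (rule linearI) (simp_all add: bil_def inner_add_left)

lemma linear_bil_right: "linear (\<lambda>y. bil A x y)"
  by (rule linearI) (simp_all add: bil_def inner_add_right matrix_vector_right_distrib matrix_vector_mult_scaleR)

lemma bil_antisym:
  assumes "transpose A = - (A :: real ^ 'n ^ 'n::finite)"
  shows "bil A x y = - bil A y x"
proof -
  have "bil A x y = (transpose A *v x) \<bullet> y"
    unfolding bil_def by (metis dot_lmul_matrix transpose_matrix_vector)
  moreover have "transpose A *v x = - (A *v x)"
    using assms matrix_vector_mult_diff_rdistrib[of 0 A x] by simp
  ultimately show ?thesis by (simp add: bil_def inner_commute)
qed

text \<open>Since \<open>\<sigma>\<close> is a bijection, slot \<open>a\<close> occurs exactly once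
  in each product, in a single factor, and that factor is linear in either argument.\<close>

lemma linear_pfaffian_slot:
  fixes A :: "real ^ 'n ^ 'n::finite"
  assumes "a < 2 * m"
  shows "linear (\<lambda>x. pfaffian_sum m (\<lambda>i j. bil A ((v(a := x)) i) ((v(a := x)) j)))"
proof -
  have "linear (\<lambda>x. \<Prod>k<m. bil A ((v(a := x)) (\<sigma> (2 * k))) ((v(a := x)) (\<sigma> (2 * k + 1))))"
    (is "linear (\<lambda>x. prod (?t x) _)")
    if p: "\<sigma> permutes {..<2 * m}" for \<sigma>
  proof -
    define b where "b = inv \<sigma> a"
    have b: "\<sigma> b = a" "b < 2 * m"
      using p assms permutes_in_image[OF permutes_inv[OF p], of a]
      by (auto simp: b_def permutes_inverses)
    define k where "k = b div 2"
    have k: "k < m" "b = 2 * k \<or> b = 2 * k + 1" using b(2) unfolding k_def by presburger+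
    have eq: "\<sigma> i = a \<longleftrightarrow> i = b" for i
      using permutes_inj[OF p] b(1) by (auto dest: injD)
    have rest: "prod (?t x) ({..<m} - {k}) = prod (?t 0) ({..<m} - {k})" for x
    proof (intro prod.cong refl)
      fix l assume "l \<in> {..<m} - {k}"
      then have "2 * l \<noteq> b" "2 * l + 1 \<noteq> b" using k by auto
      then show "?t x l = ?t 0 l" using eq by auto
    qed
    have "linear (\<lambda>x. ?t x k)"
      using k(2)
    proof
      assume "b = 2 * k"
      then have "?t x k = bil A x (v (\<sigma> (2 * k + 1)))" for x using eq by auto
      then show ?thesis by (simp add: linear_bil_left)
    next
      assume "b = 2 * k + 1"
      then have "?t x k = bil A (v (\<sigma> (2 * k))) x" for x using eq by auto
      then show ?thesis by (simp add: linear_bil_right)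
    qed
    moreover have "prod (?t x) {..<m} = prod (?t 0) ({..<m} - {k}) *\<^sub>R ?t x k" for x
      using k(1) rest[of x] by (subst prod.remove[of _ k]) auto
    ultimately show ?thesis by (simp only: linear_compose_scale_right)
  qed
  then show ?thesis
    unfolding pfaffian_sum_def
    by (intro linear_compose_sum ballI)
      (auto intro: linear_compose_scale_right[where 'b = real, unfolded real_scaleR_def])
qed

text \<open>Exchanging the two equal slots leaves the sum unchanged but reverses its sign.\<close>

lemma pfaffian_sum_repeated:
  assumes "a < 2 * m" "b < 2 * m" "a \<noteq> b" "v a = v b"
  shows "pfaffian_sum m (\<lambda>i j. W (v i) (v j)) = 0"
proof -
  have [simp]: "v (Transposition.transpose a b i) = v i" for i
    using assms(4) by (simp add: Transposition.transpose_def)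
  have "pfaffian_sum m (\<lambda>i j. W (v i) (v j)) = - pfaffian_sum m (\<lambda>i j. W (v i) (v j))"
    using pfaffian_sum_permute[OF permutes_swap_id[of a "{..<2 * m}" b], of "\<lambda>i j. W (v i) (v j)"] assms
    by (simp add: sign_swap_id)
  then show ?thesis by simp
qed

text \<open>A choice \<open>f\<close> of basis vectors either repeats one, and alternation applies,
  or it is a reordering \<open>e \<circ> p\<close> of the given enumeration, which costs only a
  sign.\<close>

lemma pfaffian_sum_zero_basis:
  fixes A :: "real ^ 'n ^ 'n::finite"
  assumes e: "bij_betw e {..<2 * m} (UNIV :: 'n set)"
    and z: "pfaffian_sum m (\<lambda>i j. A $ e i $ e j) = 0"
  shows "pfaffian_sum m (\<lambda>i j. A $ f i $ f j) = 0"
proof (cases "inj_on f {..<2 * m}")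
  case False
  then obtain a b where "a < 2 * m" "b < 2 * m" "a \<noteq> b" "f a = f b"
    by (auto simp: inj_on_def)
  then show ?thesis by (rule pfaffian_sum_repeated)
next
  case True
  define p where "p i = (if i < 2 * m then inv_into {..<2 * m} e (f i) else i)" for i
  have ep: "e (p i) = f i" "p i < 2 * m" if "i < 2 * m" for i
    using that e f_inv_into_f[of "f i" e "{..<2 * m}"] inv_into_into[of "f i" e "{..<2 * m}"]
    by (auto simp: p_def bij_betw_def)
  have "inj_on p {..<2 * m}"
    using True ep by (metis (mono_tags, lifting) inj_on_def lessThan_iff)
  then have "p permutes {..<2 * m}"
    using ep by (intro bij_imp_permutes endo_inj_surj bij_betw_imageI) (auto simp: p_def)
  from pfaffian_sum_permute[OF this, of "\<lambda>i j. A $ e i $ e j"] z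
  have "pfaffian_sum m (\<lambda>i j. A $ e (p i) $ e (p j)) = 0" by (auto simp: sign_def split: if_splits)
  moreover have "pfaffian_sum m (\<lambda>i j. A $ e (p i) $ e (p j)) = pfaffian_sum m (\<lambda>i j. A $ f i $ f j)"
    unfolding pfaffian_sum_def
  proof (intro sum.cong prod.cong arg_cong2[where f = "(*)"] refl)
    fix q k assume "q \<in> {q. q permutes {..<2 * m}}" "k \<in> {..<m}"
    then have "q (2 * k) < 2 * m" "q (2 * k + 1) < 2 * m"
      using permutes_in_image[of q "{..<2 * m}"] by auto
    then show "A $ e (p (q (2 * k))) $ e (p (q (2 * k + 1))) = A $ f (q (2 * k)) $ f (q (2 * k + 1))"
      by (simp add: ep)
  qed
  ultimately show ?thesis by simp
qed

text \<open>By multilinearity, arbitrary vectors are replaced by coordinate vectors one slot at a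
  time, until only choices of basis vectors remain.\<close>

lemma pfaffian_sum_zero:
  fixes A :: "real ^ 'n ^ 'n::finite"
  assumes e: "bij_betw e {..<2 * m} (UNIV :: 'n set)"
    and z: "pfaffian_sum m (\<lambda>i j. A $ e i $ e j) = 0"
  shows "pfaffian_sum m (\<lambda>i j. bil A (v i) (v j)) = 0"
proof -
  \<comment> \<open>Here \<open>n\<close> bounds the slots that may still hold arbitrary vectors;
    all later slots hold coordinate vectors.\<close>
  have "pfaffian_sum m (\<lambda>i j. bil A (v i) (v j)) = 0"
    if "n \<le> 2 * m" "\<forall>i\<ge>n. \<exists>l. v i = axis l 1" for n and v :: "nat \<Rightarrow> real ^ 'n"
    using that
  proof (induction n arbitrary: v)
    case 0
    then obtain f where "\<And>i. v i = axis (f i) 1" by (metis le0)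
    then show ?case using pfaffian_sum_zero_basis[OF assms] by (simp add: bil_axis)
  next
    case (Suc n)
    define L where "L x = pfaffian_sum m (\<lambda>i j. bil A ((v(n := x)) i) ((v(n := x)) j))" for x
    have L: "linear L"
      unfolding L_def using Suc.prems by (intro linear_pfaffian_slot) simp
    have "L (axis l 1) = 0" for l
      unfolding L_def
    proof (rule Suc.IH)
      show "\<forall>i\<ge>n. \<exists>l'. (v(n := axis l 1)) i = axis l' 1"
        using Suc.prems(2) by (auto simp: Suc_le_eq)
    qed (use Suc.prems in simp)
    then have "L b = 0" if "b \<in> Basis" for b using that by (auto simp: Basis_vec_def)
    then have "L x = 0" for x
      using linear_eq_stdbasis[OF L linear_zero] by metis
    from this[of "v n"] show ?case by (simp add: L_def)
  qed
  note zero = this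
  \<comment> \<open>Slots from \<open>2 * m\<close> on do not enter the sum. Filling them with a
    coordinate vector meets the condition on all indices \<open>i \<ge> 2 * m\<close>.\<close>
  define w where "w i = (if i < 2 * m then v i else axis (e 0) 1)" for i
  have "pfaffian_sum m (\<lambda>i j. bil A (w i) (w j)) = 0"
    by (rule zero[of "2 * m"]) (auto simp: w_def)
  moreover have "pfaffian_sum m (\<lambda>i j. bil A (w i) (w j)) = pfaffian_sum m (\<lambda>i j. bil A (v i) (v j))"
    unfolding pfaffian_sum_def
  proof (intro sum.cong prod.cong arg_cong2[where f = "(*)"] refl)
    fix q k assume "q \<in> {q. q permutes {..<2 * m}}" "k \<in> {..<m}"
    then have "q (2 * k) < 2 * m" "q (2 * k + 1) < 2 * m"
      using permutes_in_image[of q "{..<2 * m}"] by auto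
    then show "bil A (w (q (2 * k))) (w (q (2 * k + 1))) = bil A (v (q (2 * k))) (v (q (2 * k + 1)))"
      by (simp add: w_def)
  qed
  ultimately show ?thesis by simp
qed

section \<open>Existence of symplectic bases\<close>

lemma std_form_altdef:
  "std_form i j = (if even i \<and> j = i + 1 then 1 else if odd i \<and> i = j + 1 then - 1 else 0)"
proof -
  obtain a b where "i = 2 * a \<or> i = 2 * a + 1" "j = 2 * b \<or> j = 2 * b + 1"
    by (metis Suc_eq_plus1 evenE oddE)
  then show ?thesis unfolding std_form_def by (auto; presburger)
qed

text \<open>The symplectic Gram-Schmidt step: subtract from \<open>u\<close> its projection to the
  span of the pairs found so far.\<close>

lemma symplectic_orthogonalize:
  fixes A :: "real ^ 'n ^ 'n::finite" and v :: "nat \<Rightarrow> real ^ 'n"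
  assumes v: "\<And>i j. i < 2 * k \<Longrightarrow> j < 2 * k \<Longrightarrow> bil A (v i) (v j) = std_form i j"
  obtains u' where "u - u' \<in> span (v ` {..<2 * k})" "\<And>j. j < 2 * k \<Longrightarrow> bil A u' (v j) = 0"
proof
  \<comment> \<open>\<open>p i\<close> is the conjugate partner of index \<open>i\<close>, and
    \<open>s i\<close> is the value \<open>std_form i (p i)\<close>. In the pairing with
    \<open>v j\<close> only the summand \<open>i = p j\<close> survives, and its two signs
    cancel.\<close>
  define p where "p i = (if even i then i + 1 else i - 1)" for i :: nat
  define s where "s i = (if even i then 1 else - 1 :: real)" for i :: nat
  define u' where "u' = u - (\<Sum>i<2 * k. (s i * bil A u (v (p i))) *\<^sub>R v i)"
  show "u - u' \<in> span (v ` {..<2 * k})"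
    unfolding u'_def by (auto intro!: span_sum span_scale intro: span_base)
  fix j assume j: "j < 2 * k"
  have pj: "p j < 2 * k" "p (p j) = j" using j unfolding p_def by (auto elim!: oddE)
  have J: "std_form i j = (if i = p j then s i else 0)" for i
    unfolding std_form_altdef p_def s_def by (auto elim!: oddE evenE; presburger)
  have ss: "s i * s i = 1" for i by (simp add: s_def)
  have "bil A u' (v j) = bil A u (v j) - (\<Sum>i<2 * k. (s i * bil A u (v (p i))) * bil A (v i) (v j))"
    unfolding u'_def
    by (simp add: linear_diff[OF linear_bil_left] linear_sum[OF linear_bil_left] linear_cmul[OF linear_bil_left])
  also have "(\<Sum>i<2 * k. (s i * bil A u (v (p i))) * bil A (v i) (v j)) =
      (\<Sum>i<2 * k. if i = p j then (s i * s i) * bil A u (v (p i)) else 0)"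
    using j by (intro sum.cong) (auto simp: v J)
  also have "\<dots> = bil A u (v j)" using pj by (simp add: sum.delta ss)
  finally show "bil A u' (v j) = 0" by simp
qed

text \<open>As long as the span is proper, another conjugate pair can be added. A vector outside the
  span is made orthogonal to it and stays nonzero; nondegeneracy supplies a partner, which is made
  orthogonal as well.\<close>

lemma symplectic_basis_exists:
  fixes A :: "real ^ 'n ^ 'n::finite"
  assumes A: "transpose A = - A" and inv: "invertible A" and "2 * k \<le> CARD('n)"
  shows "\<exists>v. \<forall>i<2 * k. \<forall>j<2 * k. bil A (v i) (v j) = std_form i j"
  using assms(3)
proof (induction k)
  case 0
  then show ?case by simp
next
  case (Suc k)
  then obtain v where v: "\<And>i j. i < 2 * k \<Longrightarrow> j < 2 * k \<Longrightarrow> bil A (v i) (v j) = std_form i j"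
    by auto
  have asym: "bil A x y = - bil A y x" for x y using bil_antisym[OF A] .
  let ?V = "v ` {..<2 * k}"
  have "dim (span ?V) < CARD('n)"
    using dim_le_card'[of ?V] card_image_le[of "{..<2 * k}" v] Suc.prems by simp
  then have "span ?V \<noteq> UNIV" by (metis DIM_cart DIM_real dim_UNIV mult.right_neutral nless_le)
  then obtain u where u: "u \<notin> span ?V" by auto
  obtain x where x: "u - x \<in> span ?V" "\<And>j. j < 2 * k \<Longrightarrow> bil A x (v j) = 0"
    using symplectic_orthogonalize[OF v] by metis
  have "x \<noteq> 0" using x(1) u by auto
  obtain B where "A ** B = mat 1" using inv by (auto simp: invertible_def)
  then have B: "A *v (B *v x) = x" by (simp add: matrix_vector_mul_assoc)
  \<comment> \<open>Since \<open>A *v z\<close> is \<open>x\<close> divided by its squared Euclidean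
    length, the pairing of \<open>x\<close> with \<open>z\<close> is \<open>1\<close>.\<close>
  define z where "z = (1 / (x \<bullet> x)) *\<^sub>R (B *v x)"
  then have xz: "bil A x z = 1"
    using \<open>x \<noteq> 0\<close> B by (simp add: bil_def z_def matrix_vector_mult_scaleR)
  obtain y where y: "z - y \<in> span ?V" "\<And>j. j < 2 * k \<Longrightarrow> bil A y (v j) = 0"
    using symplectic_orthogonalize[OF v] by metis
  \<comment> \<open>The correction \<open>z - y\<close> lies in the span, to which \<open>x\<close>
    is orthogonal, so replacing \<open>z\<close> by \<open>y\<close> preserves the pairing with
    \<open>x\<close>.\<close>
  have "bil A x w = 0" if "w \<in> ?V" for w
    using that x(2) by auto
  then have "bil A x (z - y) = 0"
    using y(1) by (rule linear_eq_0_on_span[OF linear_bil_right])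
  then have xy: "bil A x y = 1" using xz by (simp add: linear_diff[OF linear_bil_right])
  have diag: "bil A w w = 0" for w using asym[of w w] by simp
  have yx: "bil A y x = - 1" using asym[of y x] xy by simp
  have o: "bil A (v j) x = 0" "bil A (v j) y = 0" if "j < 2 * k" for j
    using asym[of "v j"] x(2) y(2) that by simp_all
  define v' where "v' = v(2 * k := x, 2 * k + 1 := y)"
  have "bil A (v' i) (v' j) = std_form i j" if ij: "i < 2 * Suc k" "j < 2 * Suc k" for i j
  proof -
    have "i < 2 * k \<or> i = 2 * k \<or> i = 2 * k + 1" "j < 2 * k \<or> j = 2 * k \<or> j = 2 * k + 1"
      using ij by auto
    then show ?thesis
      using v x(2) y(2) o xy yx diag by (auto simp: v'_def std_form_def)
  qed
  then show ?case by blast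
qed

lemma pfaffian_nonzero:
  fixes A :: "real ^ 'n ^ 'n::finite"
  assumes "transpose A = - A" "invertible A" and e: "bij_betw e {..<2 * m} (UNIV :: 'n set)"
  shows "pfaffian_sum m (\<lambda>i j. A $ e i $ e j) \<noteq> 0"
proof
  assume z: "pfaffian_sum m (\<lambda>i j. A $ e i $ e j) = 0"
  have "CARD('n) = 2 * m" using bij_betw_same_card[OF e] by simp
  then obtain v where v: "\<forall>i<2 * m. \<forall>j<2 * m. bil A (v i) (v j) = std_form i j"
    using symplectic_basis_exists[OF assms(1,2), of m] by auto
  have "pfaffian_sum m (\<lambda>i j. bil A (v i) (v j)) = pfaffian_sum m std_form"
    unfolding pfaffian_sum_def
  proof (intro sum.cong prod.cong arg_cong2[where f = "(*)"] refl)
    fix q k assume "q \<in> {q. q permutes {..<2 * m}}" "k \<in> {..<m}"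
    then have "q (2 * k) < 2 * m" "q (2 * k + 1) < 2 * m"
      using permutes_in_image[of q "{..<2 * m}"] by auto
    then show "bil A (v (q (2 * k))) (v (q (2 * k + 1))) = std_form (q (2 * k)) (q (2 * k + 1))"
      by (simp add: v)
  qed
  then show False
    using pfaffian_sum_zero[OF e z, of v] pfaffian_sum_std_form[of m] by simp
qed

section \<open>The Liouville integral\<close>

text \<open>The enumeration chosen inside \<open>liouville_coeff\<close> depends on neither the
  chart nor the point, so a single \<open>e\<close> serves everywhere.\<close>

lemma liouville_coeff_pfaffian:
  fixes S :: "('a, 'n::finite) sympl_data"
  assumes "CARD('n) = 2 * m"
  obtains e where "bij_betw e {..<2 * m} (UNIV :: 'n set)"
    and "\<And>c x. liouville_coeff m S c x =
           pfaffian_sum m (\<lambda>i j. omega S c x $ e i $ e j) / (2 ^ m * fact m)"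
proof
  define e where "e = (SOME e. bij_betw e {..<2 * m} (UNIV :: 'n set))"
  have "\<exists>e. bij_betw e {..<2 * m} (UNIV :: 'n set)"
    using ex_bij_betw_nat_finite[of "UNIV :: 'n set"] assms by (simp add: atLeast0LessThan)
  then show "bij_betw e {..<2 * m} (UNIV :: 'n set)"
    unfolding e_def by (rule someI_ex)
  show "liouville_coeff m S c x =
      pfaffian_sum m (\<lambda>i j. omega S c x $ e i $ e j) / (2 ^ m * fact m)" for c x
    by (simp add: liouville_coeff_def pfaffian_sum_def e_def Let_def)
qed

section \<open>Smooth functions on open sets of coordinates\<close>

lemma smooth_fun_on_imp_differentiable:
  "smooth_fun_on W f \<Longrightarrow> y \<in> W \<Longrightarrow> f differentiable (at y)"
  unfolding smooth_fun_on_def by (drule spec[of _ "[]"]) simp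

lemma smooth_fun_on_imp_continuous_on:
  "smooth_fun_on W f \<Longrightarrow> continuous_on W f"
  by (intro continuous_at_imp_continuous_on ballI differentiable_imp_continuous_within
      smooth_fun_on_imp_differentiable)

text \<open>Every iterated derivative of \<open>g\<close> differs from that of \<open>f\<close> by a
  constant on \<open>W\<close>. Openness of \<open>W\<close> lets this equality be differentiated
  although nothing relates the functions outside \<open>W\<close>.\<close>

lemma smooth_fun_on_translate:
  fixes f :: "real ^ 'n::finite \<Rightarrow> real"
  assumes W: "open W" and f: "smooth_fun_on W f" and g: "\<And>y. y \<in> W \<Longrightarrow> g y = f y + a"
  shows "smooth_fun_on W g"
proof -
  let ?D = "\<lambda>u. foldr pderiv_vec u"
  have step: "(?D u g has_derivative frechet_derivative (?D u f) (at y)) (at y)"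
    if "y \<in> W" "\<And>y. y \<in> W \<Longrightarrow> ?D u g y = ?D u f y + b" for u y b
  proof (rule has_derivative_transform_within_open[OF _ W \<open>y \<in> W\<close>])
    show "((\<lambda>y. ?D u f y + b) has_derivative frechet_derivative (?D u f) (at y)) (at y)"
      using f \<open>y \<in> W\<close> unfolding smooth_fun_on_def
      by (intro has_derivative_add_const) (simp add: frechet_derivative_works)
  qed (use that in simp)
  \<comment> \<open>The constant is \<open>a\<close> for the empty list and \<open>0\<close> as soon
    as a derivative has been taken.\<close>
  have eq: "\<exists>b. \<forall>y\<in>W. ?D u g y = ?D u f y + b" for u
  proof (induction u)
    case Nil
    then show ?case using g by auto
  next
    case (Cons i u)
    then obtain b where "\<And>y. y \<in> W \<Longrightarrow> ?D u g y = ?D u f y + b" by auto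
    from step[OF _ this] have D: "(?D u g has_derivative frechet_derivative (?D u f) (at y)) (at y)"
      if "y \<in> W" for y using that by simp
    have "?D (i # u) g y = ?D (i # u) f y + 0" if "y \<in> W" for y
      using frechet_derivative_at[OF D[OF that]] by (simp add: pderiv_vec_def)
    then show ?case by blast
  qed
  show ?thesis
    unfolding smooth_fun_on_def
  proof (intro allI ballI)
    fix u y assume "y \<in> W"
    obtain b where "\<forall>y\<in>W. ?D u g y = ?D u f y + b" using eq by blast
    with step[OF \<open>y \<in> W\<close>] show "?D u g differentiable (at y)"
      unfolding differentiable_def by blast
  qed
qed

lemma smooth_fun_on_zero: "smooth_fun_on W (\<lambda>_. 0)"
proof -
  have "foldr pderiv_vec u (\<lambda>_. 0) = (\<lambda>_. 0)" for u :: "'a list"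
    by (induction u) (simp_all add: pderiv_vec_def)
  then show ?thesis by (simp add: smooth_fun_on_def)
qed

section \<open>Charts as homeomorphisms and partitions subordinate to them\<close>

locale sympl_manifold =
  fixes m :: nat and S :: "('a, 'n::finite) sympl_data"
  assumes closed: "closed_symplectic_manifold m S"
begin

lemma chartD:
  assumes "c \<in> charts S"
  shows "topological_chart (space_of S) c" "openin (space_of S) (fst c)" "open (snd c ` fst c)"
    "fst c \<subseteq> pts S" "inj_on (snd c) (fst c)"
    "homeomorphic_map (subtopology (space_of S) (fst c)) (top_of_set (snd c ` fst c)) (snd c)"
proof -
  show t: "topological_chart (space_of S) c"
    using assms closed by (auto simp: closed_symplectic_manifold_def maximal_smooth_atlas_def)
  then show "openin (space_of S) (fst c)" "open (snd c ` fst c)"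
    and hm: "homeomorphic_map (subtopology (space_of S) (fst c)) (top_of_set (snd c ` fst c)) (snd c)"
    by (auto simp: topological_chart_def)
  then show sub: "fst c \<subseteq> pts S" using openin_subset by blast
  show "inj_on (snd c) (fst c)"
    using homeomorphic_imp_injective_map[OF hm] sub by (simp add: Int_absorb1)
qed

lemma charts_cover: "x \<in> pts S \<Longrightarrow> \<exists>c \<in> charts S. x \<in> fst c"
  using closed unfolding closed_symplectic_manifold_def maximal_smooth_atlas_def by blast

lemma cinv_chart [simp]: "c \<in> charts S \<Longrightarrow> x \<in> fst c \<Longrightarrow> cinv c (snd c x) = x"
  unfolding cinv_def by (rule the_inv_into_f_f[OF chartD(5)])

lemma open_chart_image:
  assumes "c \<in> charts S" "openin (space_of S) U" "U \<subseteq> fst c"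
  shows "open (snd c ` U)"
proof -
  have "openin (subtopology (space_of S) (fst c)) U"
    using assms by (simp add: openin_subtopology_Int2 Int_absorb1 openin_open_subtopology chartD)
  then have "openin (top_of_set (snd c ` fst c)) (snd c ` U)"
    using homeomorphic_imp_open_map[OF chartD(6)[OF assms(1)]] by (simp add: open_map_def)
  then show ?thesis using chartD(3)[OF assms(1)] openin_open_trans by blast
qed

lemma openin_chart_vimage:
  assumes "c \<in> charts S" "open V"
  shows "openin (space_of S) {x \<in> fst c. snd c x \<in> V}"
proof -
  have "continuous_map (subtopology (space_of S) (fst c)) euclidean (snd c)"
    using homeomorphic_imp_continuous_map[OF chartD(6)[OF assms(1)]]
    by (simp add: continuous_map_in_subtopology)
  from openin_continuous_map_preimage[OF this, of V] assms(2)
  have "openin (subtopology (space_of S) (fst c)) {x \<in> fst c. snd c x \<in> V}"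
    using chartD(4)[OF assms(1)] by (simp add: Int_absorb1)
  then show ?thesis using chartD(2)[OF assms(1)] by (simp add: openin_open_subtopology)
qed

lemma compact_chart_image:
  assumes "c \<in> charts S" "compactin (space_of S) K" "K \<subseteq> fst c"
  shows "compact (snd c ` K)"
proof -
  have "compactin (subtopology (space_of S) (fst c)) K"
    using assms by (simp add: compactin_subtopology)
  then have "compactin (top_of_set (snd c ` fst c)) (snd c ` K)"
    using homeomorphic_imp_continuous_map[OF chartD(6)[OF assms(1)]] image_compactin by blast
  then show ?thesis by (simp add: compactin_subtopology)
qed

lemma compactin_chart_vimage:
  assumes "c \<in> charts S" "compact V" "V \<subseteq> snd c ` fst c"
  shows "compactin (space_of S) {x \<in> fst c. snd c x \<in> V}"
proof -
  obtain g where g: "homeomorphic_maps (subtopology (space_of S) (fst c)) (top_of_set (snd c ` fst c)) (snd c) g"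
    using chartD(6)[OF assms(1)] homeomorphic_map_maps by blast
  have gi: "\<And>x. x \<in> fst c \<Longrightarrow> g (snd c x) = x"
    using g chartD(4)[OF assms(1)] by (auto simp: homeomorphic_maps_def)
  have "compactin (top_of_set (snd c ` fst c)) V"
    using assms by (simp add: compactin_subtopology)
  then have "compactin (subtopology (space_of S) (fst c)) (g ` V)"
    using g image_compactin unfolding homeomorphic_maps_def by blast
  moreover have "g ` V = {x \<in> fst c. snd c x \<in> V}"
    using assms(3) gi by (force simp: image_iff)
  ultimately show ?thesis by (simp add: compactin_subtopology)
qed

text \<open>\<open>liouville_integral\<close> picks its partition by \<open>SOME\<close>, so
  existence is what gives access to the properties of the choice. Coordinate balls cover the
  manifold, compactness leaves finitely many, and removing the earlier ones from each makes them
  disjoint.\<close>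

lemma chart_partition_exists: "\<exists>P. chart_partition S P"
proof -
  have "\<exists>c U K. c \<in> charts S \<and> x \<in> U \<and> openin (space_of S) U \<and> compactin (space_of S) K \<and>
      U \<subseteq> K \<and> K \<subseteq> fst c" if "x \<in> pts S" for x
  proof -
    obtain c where c: "c \<in> charts S" "x \<in> fst c" using charts_cover \<open>x \<in> pts S\<close> by blast
    then obtain r where r: "r > 0" "cball (snd c x) r \<subseteq> snd c ` fst c"
      using chartD(3)[OF c(1)] by (meson imageI open_contains_cball)
    \<comment> \<open>The closed ball of the same radius still fits into the chart and supplies the
      compact set that encloses the piece.\<close>
    let ?U = "{p \<in> fst c. snd c p \<in> ball (snd c x) r}"
    let ?K = "{p \<in> fst c. snd c p \<in> cball (snd c x) r}"
    have "openin (space_of S) ?U" "compactin (space_of S) ?K"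
      using openin_chart_vimage[OF c(1) open_ball] compactin_chart_vimage[OF c(1) compact_cball r(2)]
      by blast+
    moreover have "x \<in> ?U" "?U \<subseteq> ?K" "?K \<subseteq> fst c" using c r by auto
    ultimately show ?thesis using c(1) by (intro exI[of _ c] exI[of _ ?U] exI[of _ ?K]) simp
  qed
  then obtain c U K where cUK: "\<And>x. x \<in> pts S \<Longrightarrow> c x \<in> charts S \<and> x \<in> U x \<and>
      openin (space_of S) (U x) \<and> compactin (space_of S) (K x) \<and> U x \<subseteq> K x \<and> K x \<subseteq> fst (c x)"
    by metis
  have "compactin (space_of S) (pts S)"
    using closed by (simp add: closed_symplectic_manifold_def compact_space_def)
  moreover have "pts S \<subseteq> \<Union> (U ` pts S)" using cUK by blast
  moreover have "openin (space_of S) V" if "V \<in> U ` pts S" for V using cUK that by blast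
  ultimately obtain F where F: "finite F" "F \<subseteq> U ` pts S" "pts S \<subseteq> \<Union> F"
    using compactinD[of "space_of S" "pts S" "U ` pts S"] by metis
  obtain A where A: "finite A" "A \<subseteq> pts S" "F = U ` A"
    using finite_subset_image[OF F(1,2)] by blast
  \<comment> \<open>Listing the finite cover orders it, as \<open>disjointed\<close>
    requires.\<close>
  obtain xs where xs: "set xs = A" using finite_list[OF A(1)] by blast
  define n where "n = length xs"
  define V where "V i = U (xs ! i)" for i
  have pt: "xs ! i \<in> pts S" if "i < n" for i using that A(2) xs by (auto simp: n_def)
  have V: "openin (space_of S) (V i)" "V i \<subseteq> K (xs ! i)" "K (xs ! i) \<subseteq> fst (c (xs ! i))"
      "compactin (space_of S) (K (xs ! i))" "c (xs ! i) \<in> charts S" if "i < n" for i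
    using cUK[OF pt[OF that]] by (auto simp: V_def)
  define P where "P = (\<lambda>i. (c (xs ! i), disjointed V i)) ` {..<n}"
  have "finite P" by (simp add: P_def)
  moreover have "disjoint_family_on snd P"
    unfolding disjoint_family_on_def
  proof (intro ballI impI)
    fix p q assume "p \<in> P" "q \<in> P" "p \<noteq> q"
    then obtain i j where "snd p = disjointed V i" "snd q = disjointed V j" "i \<noteq> j"
      unfolding P_def by fastforce
    then show "snd p \<inter> snd q = {}"
      using disjoint_family_disjointed[of V] by (simp add: disjoint_family_on_def)
  qed
  moreover have "(\<Union>p\<in>P. snd p) = pts S"
  proof -
    have "(\<Union>p\<in>P. snd p) = (\<Union>i<n. V i)"
      using finite_UN_disjointed_eq[of V n] by (simp add: P_def atLeast0LessThan)
    also have "\<dots> = \<Union> F"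
    proof -
      have "A = (!) xs ` {..<n}" using xs by (auto simp: n_def set_conv_nth)
      then show ?thesis by (simp add: A(3) V_def image_image)
    qed
    also have "\<dots> = pts S"
    proof
      show "\<Union> F \<subseteq> pts S" unfolding A(3) using cUK A(2) openin_subset by blast
    qed (rule F(3))
    finally show ?thesis .
  qed
  moreover have "d \<in> charts S \<and> snd d ` B \<in> sets borel \<and>
      (\<exists>K. compactin (space_of S) K \<and> B \<subseteq> K \<and> K \<subseteq> fst d)" if dB: "(d, B) \<in> P" for d B
  proof -
    obtain i where i: "i < n" "d = c (xs ! i)" "B = disjointed V i" using dB by (auto simp: P_def)
    have d: "d \<in> charts S" using i V(5) by simp
    have sub: "V i \<subseteq> fst d" using V(2,3)[OF i(1)] unfolding i(2) by (rule subset_trans)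
    have BK: "B \<subseteq> K (xs ! i)"
      using disjointed_subset[of V i] V(2)[OF i(1)] unfolding i(3) by (rule subset_trans)
    \<comment> \<open>The earlier sets may leave the chart \<open>d\<close>. Cutting them down to
      its domain keeps \<open>B\<close> the same and makes its image a difference of two open sets,
      hence Borel.\<close>
    define O' where "O' = (\<Union>j<i. V j) \<inter> fst d"
    have O': "openin (space_of S) O'" "O' \<subseteq> fst d"
      unfolding O'_def using V(1) i(1) chartD(2)[OF d] by (auto intro!: openin_Int)
    have "B = V i - O'" using sub by (auto simp: i disjointed_def O'_def atLeast0LessThan)
    then have "snd d ` B = snd d ` V i - snd d ` O'"
      using inj_on_image_set_diff[OF chartD(5)[OF d] subset_trans[OF Diff_subset sub] O'(2)] by simp
    moreover have "open (snd d ` V i)" "open (snd d ` O')"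
      using open_chart_image[OF d V(1)[OF i(1)] sub] open_chart_image[OF d O'] by simp_all
    ultimately have "snd d ` B \<in> sets borel" by (simp add: borel_open sets.Diff)
    moreover have "K (xs ! i) \<subseteq> fst d" using V(3)[OF i(1)] by (simp only: i(2))
    ultimately show ?thesis using d BK V(4)[OF i(1)] by metis
  qed
  ultimately have "chart_partition S P" by (auto simp: chart_partition_def)
  then show ?thesis ..
qed

section \<open>The Liouville measure in charts\<close>

definition pieces :: "(('a, 'n) chart \<times> 'a set) set" where
  "pieces = (SOME P. chart_partition S P)"

lemma chart_partition_pieces: "chart_partition S pieces"
  unfolding pieces_def using chart_partition_exists by (rule someI_ex)

lemma finite_pieces: "finite pieces"
  and Union_pieces: "(\<Union>p\<in>pieces. snd p) = pts S"
  using chart_partition_pieces unfolding chart_partition_def by blast+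

lemma pieceD:
  assumes "(c, B) \<in> pieces"
  shows "c \<in> charts S" "snd c ` B \<in> sets borel" "B \<subseteq> fst c"
    "\<exists>K. compactin (space_of S) K \<and> B \<subseteq> K \<and> K \<subseteq> fst c"
proof -
  have "\<forall>(c, B)\<in>pieces. c \<in> charts S \<and> snd c ` B \<in> sets borel \<and>
      (\<exists>K. compactin (space_of S) K \<and> B \<subseteq> K \<and> K \<subseteq> fst c)"
    using chart_partition_pieces unfolding chart_partition_def by (elim conjE)
  from bspec[OF this assms] have *: "c \<in> charts S" "snd c ` B \<in> sets borel"
    "\<exists>K. compactin (space_of S) K \<and> B \<subseteq> K \<and> K \<subseteq> fst c" by simp_all
  from *(1) show "c \<in> charts S" .
  from *(2) show "snd c ` B \<in> sets borel" .
  from *(3) show "\<exists>K. compactin (space_of S) K \<and> B \<subseteq> K \<and> K \<subseteq> fst c" .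
  then obtain K where "B \<subseteq> K" "K \<subseteq> fst c" by metis
  then show "B \<subseteq> fst c" by (rule subset_trans)
qed

lemma cinv_piece:
  assumes "(c, B) \<in> pieces" "y \<in> snd c ` B"
  shows "cinv c y \<in> B" "cinv c y \<in> pts S"
proof -
  obtain x where "x \<in> B" "x \<in> fst c" "y = snd c x" using assms pieceD(3) by blast
  moreover have "x \<in> pts S" using chartD(4)[OF pieceD(1)[OF assms(1)]] \<open>x \<in> fst c\<close> by blast
  ultimately show "cinv c y \<in> B" "cinv c y \<in> pts S" using pieceD(1)[OF assms(1)] by simp_all
qed

definition density :: "('a, 'n) chart \<Rightarrow> real ^ 'n \<Rightarrow> real" where
  "density c y = \<bar>liouville_coeff m S c (cinv c y)\<bar>"

lemma liouville_integral_eq: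
  "liouville_integral m S f =
     (\<Sum>(c, B)\<in>pieces. set_lebesgue_integral lborel (snd c ` B) (\<lambda>y. f (cinv c y) * density c y))"
  unfolding liouville_integral_def pieces_def density_def by (rule refl)

text \<open>The coefficient is a polynomial in the components of \<open>omega\<close>, which are
  smooth in coordinates.\<close>

lemma continuous_on_density:
  assumes c: "c \<in> charts S"
  shows "continuous_on (snd c ` fst c) (density c)"
proof -
  have card: "CARD('n) = 2 * m" and om: "symplectic_form S"
    using closed by (auto simp: closed_symplectic_manifold_def)
  obtain e where e: "\<And>c x. liouville_coeff m S c x =
      pfaffian_sum m (\<lambda>i j. omega S c x $ e i $ e j) / (2 ^ m * fact m)"
    using liouville_coeff_pfaffian[OF card] by metis
  have "continuous_on (snd c ` fst c) (\<lambda>y. omega S c (cinv c y) $ i $ j)" for i j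
    using om c smooth_fun_on_imp_continuous_on
    by (fastforce simp: symplectic_form_def smooth_on_def o_def)
  then show ?thesis
    unfolding density_def e pfaffian_sum_def
    by (intro continuous_on_divide continuous_on_rabs continuous_on_sum continuous_on_mult
        continuous_on_prod continuous_on_const) auto
qed

lemma density_pos:
  assumes c: "c \<in> charts S" and "y \<in> snd c ` fst c"
  shows "density c y > 0"
proof -
  obtain x where x: "x \<in> fst c" "y = snd c x" using assms by auto
  have card: "CARD('n) = 2 * m" and om: "symplectic_form S"
    using closed by (auto simp: closed_symplectic_manifold_def)
  obtain e where e: "bij_betw e {..<2 * m} (UNIV :: 'n set)" "\<And>c x. liouville_coeff m S c x =
      pfaffian_sum m (\<lambda>i j. omega S c x $ e i $ e j) / (2 ^ m * fact m)"
    using liouville_coeff_pfaffian[OF card] by metis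
  have om': "\<forall>i j. omega S c x $ i $ j = - omega S c x $ j $ i" "invertible (omega S c x)"
    using om c x(1) unfolding symplectic_form_def by blast+
  then have inv: "invertible (omega S c x)" by blast
  have "transpose (omega S c x) $ i $ j = - omega S c x $ i $ j" for i j
    unfolding transpose_def using om'(1)[rule_format, of j i] by simp
  then have "transpose (omega S c x) = - omega S c x"
    by (simp add: vec_eq_iff)
  from pfaffian_nonzero[OF this inv e(1)] show ?thesis
    using c x by (simp add: density_def e(2))
qed

text \<open>A class of integrands containing the smooth functions, their products and the constant
  \<open>1\<close>. The latter is in general not in \<open>smooth_functions S (pts S)\<close>, whose
  members vanish off the manifold.\<close>

definition chart_continuous :: "('a \<Rightarrow> real) \<Rightarrow> bool" where
  "chart_continuous f \<longleftrightarrow> (\<forall>c\<in>charts S. continuous_on (snd c ` fst c) (\<lambda>y. f (cinv c y)))"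

lemma smooth_imp_chart_continuous: "f \<in> smooth_functions S (pts S) \<Longrightarrow> chart_continuous f"
  unfolding chart_continuous_def
proof
  fix c assume "f \<in> smooth_functions S (pts S)" "c \<in> charts S"
  then have "smooth_fun_on (snd c ` (fst c \<inter> pts S)) (\<lambda>y. f (cinv c y))"
    by (simp add: smooth_functions_def smooth_on_def o_def)
  then show "continuous_on (snd c ` fst c) (\<lambda>y. f (cinv c y))"
    using chartD(4)[OF \<open>c \<in> charts S\<close>] smooth_fun_on_imp_continuous_on by (simp add: Int_absorb2)
qed

text \<open>A piece lies in a compact subset of its chart, where the integrand is
  continuous.\<close>

lemma set_integrable_piece:
  assumes "chart_continuous f" and cB: "(c, B) \<in> pieces"
  shows "set_integrable lborel (snd c ` B) (\<lambda>y. f (cinv c y) * density c y)"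
proof -
  obtain K where K: "compactin (space_of S) K" "B \<subseteq> K" "K \<subseteq> fst c" using pieceD(4)[OF cB] by blast
  have c: "c \<in> charts S" using pieceD(1)[OF cB] .
  have cpt: "compact (snd c ` K)" using compact_chart_image[OF c K(1,3)] .
  have "continuous_on (snd c ` K) (\<lambda>y. f (cinv c y) * density c y)"
    using assms(1) c K(3) continuous_on_density[OF c]
    by (intro continuous_on_mult) (auto simp: chart_continuous_def intro: continuous_on_subset)
  then have "set_integrable lborel (snd c ` K) (\<lambda>y. f (cinv c y) * density c y)"
    unfolding set_integrable_def using cpt by (intro borel_integrable_compact) auto
  then show ?thesis
    by (rule set_integrable_subset) (use pieceD(2)[OF cB] K(2) in auto)
qed

lemma liouville_integral_add:
  assumes "chart_continuous f" "chart_continuous g"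
  shows "liouville_integral m S (\<lambda>x. f x + g x) = liouville_integral m S f + liouville_integral m S g"
  unfolding liouville_integral_eq sum.distrib[symmetric]
proof (intro sum.cong refl)
  fix p assume p: "p \<in> pieces"
  obtain c B where cB: "p = (c, B)" by fastforce
  show "(case p of (c, B) \<Rightarrow> set_lebesgue_integral lborel (snd c ` B) (\<lambda>y. (f (cinv c y) + g (cinv c y)) * density c y)) =
      (case p of (c, B) \<Rightarrow> set_lebesgue_integral lborel (snd c ` B) (\<lambda>y. f (cinv c y) * density c y)) +
      (case p of (c, B) \<Rightarrow> set_lebesgue_integral lborel (snd c ` B) (\<lambda>y. g (cinv c y) * density c y))"
    unfolding cB prod.case distrib_right
    by (rule set_integral_add(2)[OF set_integrable_piece[OF assms(1)] set_integrable_piece[OF assms(2)]])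
      (use p cB in simp_all)
qed

lemma liouville_integral_scale:
  "liouville_integral m S (\<lambda>x. a * f x) = a * liouville_integral m S f"
  unfolding liouville_integral_eq sum_distrib_left
  unfolding split_beta mult.assoc set_integral_mult_right ..

lemma liouville_integral_cong:
  assumes "\<And>x. x \<in> pts S \<Longrightarrow> f x = g x"
  shows "liouville_integral m S f = liouville_integral m S g"
  unfolding liouville_integral_eq
proof (intro sum.cong refl)
  fix p assume p: "p \<in> pieces"
  obtain c B where cB: "p = (c, B)" by fastforce
  have "f (cinv c y) = g (cinv c y)" if "y \<in> snd c ` B" for y
    using that p assms cinv_piece(2) unfolding cB by blast
  then show "(case p of (c, B) \<Rightarrow> set_lebesgue_integral lborel (snd c ` B) (\<lambda>y. f (cinv c y) * density c y)) =
      (case p of (c, B) \<Rightarrow> set_lebesgue_integral lborel (snd c ` B) (\<lambda>y. g (cinv c y) * density c y))"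
    unfolding cB set_lebesgue_integral_def by (auto intro!: Bochner_Integration.integral_cong simp: indicator_def)
qed

text \<open>A differentiable map between spaces of equal dimension sends null sets to null sets.
  This allows null sets found in the charts of different pieces to be collected in one
  chart.\<close>

lemma negligible_transition:
  assumes c: "c \<in> charts S" and d: "d \<in> charts S" and N: "N \<subseteq> fst c \<inter> fst d" "negligible (snd c ` N)"
  shows "negligible (snd d ` N)"
proof -
  have "compatible c d"
    using c d closed unfolding closed_symplectic_manifold_def maximal_smooth_atlas_def by blast
  then have "(\<lambda>y. snd d (cinv c y) $ k) differentiable (at y)" if "y \<in> snd c ` N" for k y
    using that N(1) unfolding compatible_def
    by (intro smooth_fun_on_imp_differentiable[of "snd c ` (fst c \<inter> fst d)"]) auto
  then have "(\<lambda>y. snd d (cinv c y)) differentiable (at y)" if "y \<in> snd c ` N" for y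
    using that by (subst differentiable_componentwise_within) (auto simp: Basis_vec_def inner_axis)
  then have "(\<lambda>y. snd d (cinv c y)) differentiable_on (snd c ` N)"
    by (auto simp: differentiable_on_def intro: differentiable_at_withinI)
  then have "negligible ((\<lambda>y. snd d (cinv c y)) ` snd c ` N)"
    using N(2) by (intro negligible_differentiable_image_negligible) auto
  moreover have "(\<lambda>y. snd d (cinv c y)) ` snd c ` N = snd d ` N"
    using N(1) c by (force simp: image_iff)
  ultimately show ?thesis by simp
qed

text \<open>If \<open>f x\<close> were nonzero, the nonzero set of \<open>f\<close> in a chart
  around \<open>x\<close> would have a nonempty open image. Each piece meets this set in a null set,
  so the image would be a finite union of null sets, which is impossible.\<close>

lemma liouville_integral_eq_zeroD:
  assumes f: "chart_continuous f" "\<And>x. x \<in> pts S \<Longrightarrow> f x \<ge> 0"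
    and int: "liouville_integral m S f = 0" and x: "x \<in> pts S"
  shows "f x = 0"
proof (rule ccontr)
  assume "f x \<noteq> 0"
  obtain d where d: "d \<in> charts S" "x \<in> fst d" using charts_cover[OF x] by blast
  define W where "W = {p \<in> fst d. f p \<noteq> 0}"
  have "snd d ` W = {y \<in> snd d ` fst d. f (cinv d y) \<in> - {0}}"
    using d(1) by (auto simp: W_def)
  moreover have "continuous_on (snd d ` fst d) (\<lambda>y. f (cinv d y))"
    using f(1) d(1) by (simp add: chart_continuous_def)
  then have "open {y \<in> snd d ` fst d. f (cinv d y) \<in> - {0}}"
    using continuous_open_preimage[OF _ chartD(3)[OF d(1)], of "\<lambda>y. f (cinv d y)" "- {0}"]
    by (simp add: Int_def vimage_def open_Compl)
  ultimately have W: "open (snd d ` W)" "snd d ` W \<noteq> {}"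
    using d(2) \<open>f x \<noteq> 0\<close> by (auto simp: W_def)
  have "negligible (snd d ` (W \<inter> B))" if cB: "(c, B) \<in> pieces" for c B
  proof (rule negligible_transition)
    show c: "c \<in> charts S" "d \<in> charts S" "W \<inter> B \<subseteq> fst c \<inter> fst d"
      using pieceD[OF cB] d by (auto simp: W_def)
    let ?h = "\<lambda>c B y. indicator (snd c ` B) y *\<^sub>R (f (cinv c y) * density c y)"
    have h: "?h c B y \<ge> 0" if "(c, B) \<in> pieces" for c B y
    proof (cases "y \<in> snd c ` B")
      case True
      then show ?thesis
        using cinv_piece(2)[OF that] f(2) by (simp add: density_def)
    qed simp
    have "(\<Sum>(c, B)\<in>pieces. integral\<^sup>L lborel (?h c B)) = 0"
      using int by (simp add: liouville_integral_eq set_lebesgue_integral_def)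
    \<comment> \<open>A vanishing finite sum of nonnegative integrals has only vanishing
      terms.\<close>
    then have "integral\<^sup>L lborel (?h c B) = 0"
      using h cB finite_pieces by (subst (asm) sum_nonneg_eq_0_iff) (auto intro!: integral_nonneg_AE)
    then have "AE y in lborel. ?h c B y = 0"
      using set_integrable_piece[OF f(1) cB] h[OF cB]
      by (subst (asm) integral_nonneg_eq_0_iff_AE) (auto simp: set_integrable_def)
    then have "AE y in lebesgue. ?h c B y = 0" by (rule AE_completion)
    then have "negligible {y. ?h c B y \<noteq> 0}"
      by (simp add: negligible_iff_null_sets completion.AE_iff_null_sets)
    \<comment> \<open>Positivity of the density enters here: on the piece, the integrand is nonzero
      wherever \<open>f\<close> is.\<close>
    moreover have "snd c ` (W \<inter> B) \<subseteq> {y. ?h c B y \<noteq> 0}"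
    proof
      fix y assume "y \<in> snd c ` (W \<inter> B)"
      then obtain p where p: "p \<in> W" "p \<in> B" "y = snd c p" by blast
      then have "p \<in> fst c" using pieceD(3)[OF cB] by blast
      then have "density c y > 0" "cinv c y = p" using density_pos[OF c(1)] c(1) p(3) by auto
      then show "y \<in> {y. ?h c B y \<noteq> 0}" using p by (auto simp: W_def)
    qed
    ultimately show "negligible (snd c ` (W \<inter> B))" by (rule negligible_subset)
  qed
  then have "negligible (\<Union>p\<in>pieces. snd d ` (W \<inter> snd p))"
    using finite_pieces by (intro negligible_Union) auto
  moreover have "W = (\<Union>p\<in>pieces. W \<inter> snd p)"
    using Union_pieces chartD(4)[OF d(1)] unfolding W_def by blast
  then have "snd d ` W = (\<Union>p\<in>pieces. snd d ` (W \<inter> snd p))"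
    by (metis image_UN)
  ultimately show False using open_not_negligible[OF W] by simp
qed

text \<open>The case distinction keeps the function zero off the manifold, as
  \<open>smooth_functions\<close> demands; inside any chart it is a plain translation.\<close>

lemma smooth_functions_translate:
  assumes "f \<in> smooth_functions S (pts S)"
  shows "(\<lambda>x. if x \<in> pts S then f x + a else 0) \<in> smooth_functions S (pts S)"
  unfolding smooth_functions_def smooth_on_def
proof (intro CollectI conjI ballI)
  fix c assume c: "c \<in> charts S"
  then have i: "fst c \<inter> pts S = fst c" using chartD(4) by blast
  have "smooth_fun_on (snd c ` fst c) (f \<circ> cinv c)"
    using assms c i by (auto simp: smooth_functions_def smooth_on_def)
  then show "smooth_fun_on (snd c ` (fst c \<inter> pts S)) ((\<lambda>x. if x \<in> pts S then f x + a else 0) \<circ> cinv c)"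
    unfolding i
  proof (rule smooth_fun_on_translate[OF chartD(3)[OF c]])
    fix y assume "y \<in> snd c ` fst c"
    then obtain x where "x \<in> fst c" "y = snd c x" by blast
    moreover from this have "x \<in> pts S" using chartD(4)[OF c] by blast
    ultimately show "((\<lambda>x. if x \<in> pts S then f x + a else 0) \<circ> cinv c) y = (f \<circ> cinv c) y + a"
      using c by simp
  qed
qed simp

lemma zero_in_smooth_functions: "(\<lambda>_. 0) \<in> smooth_functions S V"
  by (simp add: smooth_functions_def smooth_on_def o_def smooth_fun_on_zero)

text \<open>Test \<open>g\<close> against \<open>g\<close> minus its mean.\<close>

lemma constant_if_orthogonal_to_zero_mean:
  assumes g: "g \<in> smooth_functions S (pts S)"
    and orth: "\<And>H. H \<in> zero_mean_functions m S \<Longrightarrow> liouville_integral m S (\<lambda>x. H x * g x) = 0"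
  shows "\<exists>a. \<forall>x\<in>pts S. g x = a"
proof (cases "pts S = {}")
  case False
  let ?I = "liouville_integral m S"
  have one: "chart_continuous (\<lambda>_. 1)" by (simp add: chart_continuous_def)
  \<comment> \<open>Zero total volume would force the constant \<open>1\<close> to vanish at a point
    of the nonempty manifold.\<close>
  have vol: "?I (\<lambda>_. 1) \<noteq> 0" using liouville_integral_eq_zeroD[OF one] False by fastforce
  define a where "a = ?I g / ?I (\<lambda>_. 1)"
  define H where "H x = (if x \<in> pts S then g x + - a else 0)" for x
  have H: "H \<in> smooth_functions S (pts S)"
    unfolding H_def using g by (rule smooth_functions_translate)
  have cont: "chart_continuous g" "chart_continuous H"
    using g H smooth_imp_chart_continuous by auto
  have lin: "chart_continuous (\<lambda>x. b * f x)" if "chart_continuous f" for b f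
    using that by (auto simp: chart_continuous_def intro!: continuous_intros)
  have "?I H = ?I (\<lambda>x. g x + - a * 1)"
    by (rule liouville_integral_cong) (simp add: H_def)
  also have "\<dots> = ?I g + - a * ?I (\<lambda>_. 1)"
    by (subst liouville_integral_add[OF cont(1) lin[OF one]]) (simp only: liouville_integral_scale)
  also have "\<dots> = 0" using vol by (simp add: a_def)
  finally have I0: "?I H = 0" .
  have sq: "chart_continuous (\<lambda>x. H x * H x)"
    using cont(2) by (auto simp: chart_continuous_def intro!: continuous_intros)
  \<comment> \<open>On the manifold \<open>g = H + a\<close>, and the term \<open>a * H\<close>
    integrates to zero.\<close>
  have "?I (\<lambda>x. H x * g x) = ?I (\<lambda>x. H x * H x + a * H x)"
    by (rule liouville_integral_cong) (simp add: H_def algebra_simps)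
  also have "\<dots> = ?I (\<lambda>x. H x * H x) + a * ?I H"
    by (subst liouville_integral_add[OF sq lin[OF cont(2)]]) (simp only: liouville_integral_scale)
  finally have "?I (\<lambda>x. H x * H x) = 0"
    using orth[of H] H I0 by (simp add: zero_mean_functions_def)
  then have "H x * H x = 0" if "x \<in> pts S" for x
    by (intro liouville_integral_eq_zeroD[OF sq _ _ that]) simp_all
  then have "g x = a" if "x \<in> pts S" for x using that by (simp add: H_def)
  then show ?thesis by blast
qed simp

section \<open>From the trace density to the functional\<close>

lemma fls_nth_trace_const:
  assumes \<rho>: "is_trace_density m S tr \<rho>" and H: "H \<in> smooth_functions S (pts S)"
  shows "fls_nth (tr (\<lambda>x. fps_const (H x))) k = liouville_integral m S (\<lambda>x. H x * fls_nth (\<rho> x) k)"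
proof -
  have "(\<lambda>x. fps_nth (fps_const (H x)) k) \<in> smooth_functions S (pts S)" for k
    using H by (cases "k = 0") (simp_all add: zero_in_smooth_functions)
  then have "(\<lambda>x. fps_const (H x)) \<in> formal_functions S (pts S)"
    by (simp add: formal_functions_def)
  then have tr: "tr (\<lambda>x. fps_const (H x)) =
      Abs_fls (\<lambda>k. liouville_integral m S (\<lambda>x. H x * fls_nth (\<rho> x) k))"
    using \<rho> by (simp add: is_trace_density_def liouville_integral_fls_def)
  \<comment> \<open>\<open>Abs_fls\<close> returns the given coefficients only if they vanish below
    some index; the uniform bound on the pole order of \<open>\<rho>\<close> provides one.\<close>
  obtain N where "\<forall>x. \<forall>k<N. fls_nth (\<rho> x) k = 0"
    using \<rho> by (auto simp: is_trace_density_def laurent_functions_def)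
  then have "\<forall>k<N. liouville_integral m S (\<lambda>x. H x * fls_nth (\<rho> x) k) = 0"
    using liouville_integral_scale[of 0 "\<lambda>_. 0"] by simp
  then show ?thesis unfolding tr by (subst nth_Abs_fls_ex_lower_bound) auto
qed

lemma closed_iff_mu_zero:
  assumes \<rho>: "is_trace_density m S tr \<rho>"
  shows "closed_star_product S \<rho> \<longleftrightarrow> (\<forall>H \<in> zero_mean_functions m S. mu_tilde m tr H = 0)"
proof
  assume "closed_star_product S \<rho>"
  then obtain z where z: "\<And>x. x \<in> pts S \<Longrightarrow> \<rho> x = z" by (auto simp: closed_star_product_def)
  show "\<forall>H \<in> zero_mean_functions m S. mu_tilde m tr H = 0"
  proof
    fix H assume H: "H \<in> zero_mean_functions m S"
    have "fls_nth (tr (\<lambda>x. fps_const (H x))) k = 0" for k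
    proof -
      have "liouville_integral m S (\<lambda>x. H x * fls_nth (\<rho> x) k) =
          liouville_integral m S (\<lambda>x. fls_nth z k * H x)"
        by (rule liouville_integral_cong) (simp add: z)
      then show ?thesis
        using H fls_nth_trace_const[OF \<rho>] by (simp add: zero_mean_functions_def liouville_integral_scale)
    qed
    then have "tr (\<lambda>x. fps_const (H x)) = 0" by (intro fls_eqI) simp
    then show "mu_tilde m tr H = 0" by (simp add: mu_tilde_def)
  qed
next
  assume mu: "\<forall>H \<in> zero_mean_functions m S. mu_tilde m tr H = 0"
  \<comment> \<open>The factor in \<open>mu_tilde\<close> is a nonzero constant times a power of
    \<nu>, hence invertible.\<close>
  have tr0: "tr (\<lambda>x. fps_const (H x)) = 0" if "H \<in> zero_mean_functions m S" for H
    using bspec[OF mu that] by (auto simp: mu_tilde_def fls_shift_eq0_iff)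
  have "\<exists>a. \<forall>x\<in>pts S. fls_nth (\<rho> x) k = a" for k
  proof (rule constant_if_orthogonal_to_zero_mean)
    show "(\<lambda>x. fls_nth (\<rho> x) k) \<in> smooth_functions S (pts S)"
      using \<rho> by (simp add: is_trace_density_def laurent_functions_def)
    show "liouville_integral m S (\<lambda>x. H x * fls_nth (\<rho> x) k) = 0" if "H \<in> zero_mean_functions m S" for H
      using fls_nth_trace_const[OF \<rho>, of H k] tr0[OF that] that by (simp add: zero_mean_functions_def)
  qed
  then obtain z where z: "\<And>k x. x \<in> pts S \<Longrightarrow> fls_nth (\<rho> x) k = z k" by metis
  \<comment> \<open>Comparing two points avoids assembling the numbers \<open>z k\<close> into a
    Laurent series: the value of \<open>\<rho>\<close> at any point serves as the constant.\<close>
  have "\<rho> x = \<rho> y" if "x \<in> pts S" "y \<in> pts S" for x y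
    using z that by (intro fls_eqI) simp
  then show "closed_star_product S \<rho>"
    unfolding closed_star_product_def by blast
qed

end

theorem corollary3p12:
  fixes S :: "('a, 'n::finite) sympl_data"
    and G :: "('a, 'n) christoffel"
    and m :: nat
    and tr :: "('a \<Rightarrow> real fps) \<Rightarrow> real fls"
    and \<rho> :: "'a \<Rightarrow> real fls"
  assumes "closed_symplectic_manifold m S"
    and "symplectic_connection S G"
    and "normalised_trace m S G tr"
    and "is_trace_density m S tr \<rho>"
  shows "closed_star_product S \<rho> \<longleftrightarrow> (\<forall>H \<in> zero_mean_functions m S. mu_tilde m tr H = 0)"
proof -
  interpret sympl_manifold m S by standard fact
  show ?thesis using assms(4) by (rule closed_iff_mu_zero)
qed

end
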